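(* Let $d\ge 1$, let $\mathcal{H}=L_2(\mathbb{R}^d)$ be the complex Hilbert space of square-integrable functions with respect to Lebesgue measure, and let $u\in\mathcal{H}$. Let $\{\xi_n\}_{n\ge 1}$ be independent identically distributed zero-mean random vectors in $\mathbb{R}^d$ with covariance matrix $\Sigma\in\mathbb{R}^{d\times d}$, and let $\eta\sim N(0,\Sigma)$ be a Gaussian random vector in $\mathbb{R}^d$. Then the random pure states $\rho\left[S_{\xi_1/\sqrt n}\cdots S_{\xi_n/\sqrt n}u\right]$ converge in distribution in the weak operator topology to the random pure state $\rho[S_\eta u]$; that is, for every bounded linear operator $A\in B(\mathcal{H})$, $$\operatorname{tr}\left(\rho\left[S_{\xi_1/\sqrt n}\cdots S_{\xi_n/\sqrt n}u\right]A\right)\xrightarrow[n\to\infty]{d}\operatorname{tr}\left(\rho[S_\eta u]A\right).$$ Moreover, for every $A\in B(\mathcal{H})$, $$\mathbb{E}\operatorname{tr}\left(\rho\left[S_{\xi_1/\sqrt n}\cdots S_{\xi_n/\sqrt n}u\right]A\right)\xrightarrow[n\to\infty]{}\mathbb{E}\operatorname{tr}\left(\rho[S_\eta u]A\right).$$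
   Context: For $a\in\mathbb{R}^d$, the shift operator $S_a:\mathcal{H}\to\mathcal{H}$ is $(S_a u)(x):=u(x+a)$. For $u\in\mathcal{H}$ (not necessarily of norm one), the pure state $\rho[u]:=|u\rangle\langle u|$ is the trace-class operator $v\mapsto\langle u,v\rangle u$, where $\langle\cdot,\cdot\rangle$ is the inner product of $\mathcal{H}$, linear in the second argument. $B(\mathcal{H})$ is the space of bounded linear operators on $\mathcal{H}$. Random states $\rho_n$ are said to converge in distribution in the weak operator topology (WOT) to a random state $\rho$ if for each $A\in B(\mathcal{H})$ the (complex-valued) random variables $\operatorname{tr}(\rho_nA)$ converge in distribution to $\operatorname{tr}(\rho A)$. $\mathbb{E}$ denotes expected value. *)

theory Defs
  imports "HOL-Probability.Probability"
begin

definition square_integrable :: "('a::euclidean_space \<Rightarrow> complex) \<Rightarrow> bool" where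
  "square_integrable f \<longleftrightarrow>
     f \<in> borel_measurable lborel \<and> integrable lborel (\<lambda>x. (cmod (f x))\<^sup>2)"

lemma square_integrable_cnj_mult:
  assumes "square_integrable f" "square_integrable g"
  shows "integrable lborel (\<lambda>x. cnj (f x) * g x)"
proof (rule Bochner_Integration.integrable_bound)
  show "integrable lborel (\<lambda>x. (cmod (f x))\<^sup>2 + (cmod (g x))\<^sup>2)"
    using assms by (simp add: square_integrable_def)
  have [measurable]: "f \<in> borel_measurable borel" "g \<in> borel_measurable borel"
    using assms by (simp_all add: square_integrable_def)
  have [measurable]: "(\<lambda>x. cnj (f x)) \<in> borel_measurable borel"
    by (rule borel_measurable_continuous_on[where f = cnj]) (auto intro: continuous_intros)
  show "(\<lambda>x. cnj (f x) * g x) \<in> borel_measurable lborel"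
    by simp
  show "AE x in lborel. norm (cnj (f x) * g x) \<le> norm ((cmod (f x))\<^sup>2 + (cmod (g x))\<^sup>2)"
  proof (rule AE_I2)
    fix x
    have "2 * (cmod (f x) * cmod (g x)) \<le> (cmod (f x))\<^sup>2 + (cmod (g x))\<^sup>2"
      using sum_squares_bound[of "cmod (f x)" "cmod (g x)"] by (simp add: mult.assoc)
    moreover have "0 \<le> cmod (f x) * cmod (g x)" by simp
    ultimately have "cmod (f x) * cmod (g x) \<le> (cmod (f x))\<^sup>2 + (cmod (g x))\<^sup>2" by linarith
    then show "norm (cnj (f x) * g x) \<le> norm ((cmod (f x))\<^sup>2 + (cmod (g x))\<^sup>2)"
      by (simp add: norm_mult)
  qed
qed

lemma square_integrable_zero: "square_integrable (\<lambda>x. 0)"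
  by (simp add: square_integrable_def)

lemma square_integrable_scale:
  "square_integrable f \<Longrightarrow> square_integrable (\<lambda>x. c * f x)"
  by (auto simp: square_integrable_def norm_mult power_mult_distrib)

lemma square_integrable_add:
  assumes "square_integrable f" "square_integrable g"
  shows "square_integrable (\<lambda>x. f x + g x)"
  unfolding square_integrable_def
proof
  have [measurable]: "f \<in> borel_measurable lborel" "g \<in> borel_measurable lborel"
    using assms by (simp_all add: square_integrable_def)
  show "(\<lambda>x. f x + g x) \<in> borel_measurable lborel" by measurable
  show "integrable lborel (\<lambda>x. (cmod (f x + g x))\<^sup>2)"
  proof (rule Bochner_Integration.integrable_bound)
    show "integrable lborel (\<lambda>x. 2 * (cmod (f x))\<^sup>2 + 2 * (cmod (g x))\<^sup>2)"
      using assms by (simp add: square_integrable_def)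
    show "(\<lambda>x. (cmod (f x + g x))\<^sup>2) \<in> borel_measurable lborel" by measurable
    show "AE x in lborel. norm ((cmod (f x + g x))\<^sup>2)
            \<le> norm (2 * (cmod (f x))\<^sup>2 + 2 * (cmod (g x))\<^sup>2)"
    proof (rule AE_I2)
      fix x
      have "(cmod (f x + g x))\<^sup>2 \<le> (cmod (f x) + cmod (g x))\<^sup>2"
        by (intro power_mono norm_triangle_ineq) simp
      also have "\<dots> \<le> 2 * (cmod (f x))\<^sup>2 + 2 * (cmod (g x))\<^sup>2"
        using sum_squares_bound[of "cmod (f x)" "cmod (g x)"]
        by (simp add: power2_eq_square algebra_simps)
      finally show "norm ((cmod (f x + g x))\<^sup>2)
            \<le> norm (2 * (cmod (f x))\<^sup>2 + 2 * (cmod (g x))\<^sup>2)" by simp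
    qed
  qed
qed

lemma square_integrable_shift:
  assumes "square_integrable f"
  shows "square_integrable (\<lambda>x. f (x + a))"
proof -
  have [measurable]: "f \<in> borel_measurable borel"
    using assms by (simp add: square_integrable_def)
  have "integrable (distr lborel borel ((+) a)) (\<lambda>x. (cmod (f x))\<^sup>2)"
    using assms by (simp add: square_integrable_def lborel_distr_plus)
  then have "integrable lborel (\<lambda>x. (cmod (f (a + x)))\<^sup>2)"
    by (subst (asm) integrable_distr_eq) auto
  then show ?thesis
    by (simp add: square_integrable_def add.commute)
qed

lemma AE_lborel_shift:
  fixes a :: "'a::euclidean_space"
  assumes [measurable]: "Measurable.pred borel P"
    and P: "AE x in lborel. P x"
  shows "AE x in lborel. P (x + a)"
proof -
  have "AE x in distr lborel borel ((+) a). P x"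
    using P by (simp only: lborel_distr_plus)
  then show ?thesis
    by (subst (asm) AE_distr_iff) (auto simp: add.commute)
qed

text \<open>Elements of \<open>L\<^sub>2\<close> are classes of Borel representatives modulo Lebesgue-null sets;
  every Lebesgue measurable function agrees almost everywhere with a Borel one.\<close>

definition L2_rel :: "('a::euclidean_space \<Rightarrow> complex) \<Rightarrow> ('a \<Rightarrow> complex) \<Rightarrow> bool" where
  "L2_rel f g \<longleftrightarrow> square_integrable f \<and> square_integrable g \<and> (AE x in lborel. f x = g x)"

quotient_type (overloaded) 'a L2 = "'a::euclidean_space \<Rightarrow> complex" / partial: L2_rel
proof (rule part_equivpI)
  show "\<exists>f::'a \<Rightarrow> complex. L2_rel f f"
    using square_integrable_zero by (auto simp: L2_rel_def intro: exI[of _ "\<lambda>x. 0"])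
  show "symp (L2_rel :: ('a \<Rightarrow> complex) \<Rightarrow> _)"
    by (auto simp: symp_def L2_rel_def)
  show "transp (L2_rel :: ('a \<Rightarrow> complex) \<Rightarrow> _)"
    unfolding transp_def L2_rel_def by auto
qed

text \<open>The complex inner product is linear in the second argument.\<close>

lift_definition cinner :: "'a::euclidean_space L2 \<Rightarrow> 'a L2 \<Rightarrow> complex"
  is "\<lambda>f g. \<integral>x. cnj (f x) * g x \<partial>lborel"
proof -
  fix f f' g g' :: "'a \<Rightarrow> complex"
  assume "L2_rel f f'" "L2_rel g g'"
  then have *: "square_integrable f" "square_integrable f'"
    "square_integrable g" "square_integrable g'"
    "AE x in lborel. f x = f' x" "AE x in lborel. g x = g' x"
    by (auto simp: L2_rel_def)
  show "(\<integral>x. cnj (f x) * g x \<partial>lborel) = (\<integral>x. cnj (f' x) * g' x \<partial>lborel)"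
    using *(5,6)
    by (intro integral_cong_AE borel_measurable_integrable square_integrable_cnj_mult *) auto
qed

lift_definition scaleC :: "complex \<Rightarrow> 'a::euclidean_space L2 \<Rightarrow> 'a L2"
  is "\<lambda>c f x. c * f x"
  by (auto simp: L2_rel_def intro: square_integrable_scale)

instantiation L2 :: (euclidean_space) real_vector
begin

lift_definition zero_L2 :: "'a L2" is "\<lambda>x. 0"
  by (auto simp: L2_rel_def square_integrable_zero)

lift_definition plus_L2 :: "'a L2 \<Rightarrow> 'a L2 \<Rightarrow> 'a L2" is "\<lambda>f g x. f x + g x"
  by (auto simp: L2_rel_def intro: square_integrable_add)

definition scaleR_L2 :: "real \<Rightarrow> 'a L2 \<Rightarrow> 'a L2" where
  "scaleR_L2 r u = scaleC (complex_of_real r) u"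

definition uminus_L2 :: "'a L2 \<Rightarrow> 'a L2" where
  "uminus_L2 u = scaleC (-1) u"

definition minus_L2 :: "'a L2 \<Rightarrow> 'a L2 \<Rightarrow> 'a L2" where
  "minus_L2 u v = u + - v"

instance
proof
  fix u v w :: "'a L2" and r s :: real
  show "u + v + w = u + (v + w)"
    by transfer (auto simp: L2_rel_def add.assoc intro!: square_integrable_add)
  show "u + v = v + u"
    by transfer (auto simp: L2_rel_def add.commute intro!: square_integrable_add)
  show "0 + u = u"
    by transfer (auto simp: L2_rel_def)
  show "- u + u = 0"
    unfolding uminus_L2_def
    by transfer (auto simp: L2_rel_def square_integrable_zero)
  show "u - v = u + - v"
    by (simp add: minus_L2_def)
  show "r *\<^sub>R (u + v) = r *\<^sub>R u + r *\<^sub>R v"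
    unfolding scaleR_L2_def
    by transfer (auto simp: L2_rel_def distrib_left
        intro!: square_integrable_add square_integrable_scale)
  show "(r + s) *\<^sub>R u = r *\<^sub>R u + s *\<^sub>R u"
    unfolding scaleR_L2_def
    by transfer (auto simp: L2_rel_def distrib_right
        intro!: square_integrable_add square_integrable_scale)
  show "r *\<^sub>R s *\<^sub>R u = (r * s) *\<^sub>R u"
    unfolding scaleR_L2_def
    by transfer (auto simp: L2_rel_def mult.assoc intro!: square_integrable_scale)
  show "1 *\<^sub>R u = u"
    unfolding scaleR_L2_def
    by transfer (auto simp: L2_rel_def)
qed

end

lemma cinner_commute: "cinner u v = cnj (cinner v u)"
proof transfer
  fix u v :: "'a \<Rightarrow> complex"
  show "(\<integral>x. cnj (u x) * v x \<partial>lborel) = cnj (\<integral>x. cnj (v x) * u x \<partial>lborel)"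
    by (subst Bochner_Integration.integral_cnj[symmetric]) (simp add: mult.commute)
qed

lemma cinner_add_right: "cinner u (v + w) = cinner u v + cinner u w"
  by transfer (auto simp: L2_rel_def distrib_left square_integrable_cnj_mult)

lemma cinner_scaleC_right: "cinner u (scaleC c v) = c * cinner u v"
proof transfer
  fix u v :: "'a \<Rightarrow> complex" and c :: complex
  have "(\<lambda>x. cnj (u x) * (c * v x)) = (\<lambda>x. c * (cnj (u x) * v x))"
    by (simp add: mult.left_commute)
  then show "(\<integral>x. cnj (u x) * (c * v x) \<partial>lborel) = c * (\<integral>x. cnj (u x) * v x \<partial>lborel)"
    by simp
qed

lemma cinner_self: "square_integrable f \<Longrightarrow>
    (\<integral>x. cnj (f x) * f x \<partial>lborel) = complex_of_real (\<integral>x. (cmod (f x))\<^sup>2 \<partial>lborel)"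
  by (simp add: mult.commute[of "cnj _"] complex_norm_square[symmetric]
      flip: integral_complex_of_real)

instantiation L2 :: (euclidean_space) real_inner
begin

definition inner_L2 :: "'a L2 \<Rightarrow> 'a L2 \<Rightarrow> real" where
  "inner_L2 u v = Re (cinner u v)"

definition norm_L2 :: "'a L2 \<Rightarrow> real" where
  "norm_L2 u = sqrt (inner u u)"

definition sgn_L2 :: "'a L2 \<Rightarrow> 'a L2" where
  "sgn_L2 u = u /\<^sub>R norm u"

definition dist_L2 :: "'a L2 \<Rightarrow> 'a L2 \<Rightarrow> real" where
  "dist_L2 u v = norm (u - v)"

definition uniformity_L2 :: "('a L2 \<times> 'a L2) filter" where
  "uniformity_L2 = (INF e\<in>{0<..}. principal {(u, v). dist u v < e})"

definition open_L2 :: "'a L2 set \<Rightarrow> bool" where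
  "open_L2 U \<longleftrightarrow> (\<forall>u\<in>U. \<forall>\<^sub>F (u', v) in uniformity. u' = u \<longrightarrow> v \<in> U)"

instance
proof
  fix u v w :: "'a L2" and r :: real and U :: "'a L2 set"
  show "dist u v = norm (u - v)" by (rule dist_L2_def)
  show "uniformity = (INF e\<in>{0<..}. principal {(u::'a L2, v). dist u v < e})"
    by (rule uniformity_L2_def)
  show "open U \<longleftrightarrow> (\<forall>u\<in>U. \<forall>\<^sub>F (u', v) in uniformity. u' = u \<longrightarrow> v \<in> U)"
    by (rule open_L2_def)
  show "sgn u = u /\<^sub>R norm u" by (rule sgn_L2_def)
  show "norm u = sqrt (inner u u)" by (rule norm_L2_def)
  show comm: "inner u v = inner v u" for u v :: "'a L2"
    unfolding inner_L2_def by (subst cinner_commute) simp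
  have "inner w (u + v) = inner w u + inner w v"
    by (simp add: inner_L2_def cinner_add_right)
  then show "inner (u + v) w = inner u w + inner v w" by (simp only: comm)
  have "inner v (r *\<^sub>R u) = r * inner v u"
    by (simp add: inner_L2_def scaleR_L2_def cinner_scaleC_right)
  then show "inner (r *\<^sub>R u) v = r * inner u v" by (simp only: comm)
  show "0 \<le> inner u u"
    unfolding inner_L2_def by transfer (simp add: L2_rel_def cinner_self)
  show "inner u u = 0 \<longleftrightarrow> u = 0"
    unfolding inner_L2_def
  proof transfer
    fix f :: "'a \<Rightarrow> complex"
    assume "L2_rel f f"
    then have f: "square_integrable f" by (simp add: L2_rel_def)
    then have "(\<integral>x. (cmod (f x))\<^sup>2 \<partial>lborel) = 0 \<longleftrightarrow> (AE x in lborel. (cmod (f x))\<^sup>2 = 0)"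
      by (intro integral_nonneg_eq_0_iff_AE) (auto simp: square_integrable_def)
    then show "(Re (\<integral>x. cnj (f x) * f x \<partial>lborel) = 0) = L2_rel f (\<lambda>x. 0)"
      using f by (simp add: cinner_self L2_rel_def square_integrable_zero)
  qed
qed

end

text \<open>Here \<^const>\<open>bounded_linear\<close> only yields real-linearity.\<close>

definition bounded_clinear :: "('a::euclidean_space L2 \<Rightarrow> 'a L2) \<Rightarrow> bool" where
  "bounded_clinear A \<longleftrightarrow> bounded_linear A \<and> (\<forall>c v. A (scaleC c v) = scaleC c (A v))"

definition orthonormal_basis :: "'a::euclidean_space L2 set \<Rightarrow> bool" where
  "orthonormal_basis B \<longleftrightarrow>
     (\<forall>e\<in>B. \<forall>f\<in>B. cinner e f = (if e = f then 1 else 0)) \<and>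
     (\<forall>v. (\<forall>e\<in>B. cinner e v = 0) \<longrightarrow> v = 0)"

text \<open>The value of the trace is the one common to all orthonormal bases; for operators
  that are not trace class it is unspecified.\<close>

definition op_trace :: "('a::euclidean_space L2 \<Rightarrow> 'a L2) \<Rightarrow> complex" where
  "op_trace T = (THE t. \<forall>B. orthonormal_basis B \<longrightarrow> ((\<lambda>e. cinner e (T e)) has_sum t) B)"

definition pure_state :: "'a::euclidean_space L2 \<Rightarrow> 'a L2 \<Rightarrow> 'a L2" where
  "pure_state u = (\<lambda>v. scaleC (cinner u v) u)"

lift_definition shift_op :: "'a::euclidean_space \<Rightarrow> 'a L2 \<Rightarrow> 'a L2"
  is "\<lambda>a f x. f (x + a)"
proof -
  fix a :: 'a and f g :: "'a \<Rightarrow> complex"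
  assume "L2_rel f g"
  then have fg: "square_integrable f" "square_integrable g" "AE x in lborel. f x = g x"
    by (auto simp: L2_rel_def)
  have [measurable]: "f \<in> borel_measurable borel" "g \<in> borel_measurable borel"
    using fg by (simp_all add: square_integrable_def)
  have "AE x in lborel. f (x + a) = g (x + a)"
    by (rule AE_lborel_shift[where P = "\<lambda>x. f x = g x"]) (use fg in auto)
  then show "L2_rel (\<lambda>x. f (x + a)) (\<lambda>x. g (x + a))"
    using fg by (simp add: L2_rel_def square_integrable_shift)
qed

text \<open>\<open>shift_prod n a u\<close> is \<open>S\<^bsub>a 1\<^esub> (S\<^bsub>a 2\<^esub> (\<dots> (S\<^bsub>a n\<^esub> u)))\<close>.\<close>

definition shift_prod :: "nat \<Rightarrow> (nat \<Rightarrow> 'a::euclidean_space) \<Rightarrow> 'a L2 \<Rightarrow> 'a L2" where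
  "shift_prod n a u = foldr (\<lambda>k. shift_op (a k)) [1..<Suc n] u"

text \<open>Weak convergence of the laws. The limit variable may live on a different probability
  space. The library's \<^const>\<open>weak_conv_m\<close> covers real-valued variables only.\<close>

definition conv_in_distr ::
  "'w measure \<Rightarrow> (nat \<Rightarrow> 'w \<Rightarrow> 'b::metric_space) \<Rightarrow> 'v measure \<Rightarrow> ('v \<Rightarrow> 'b) \<Rightarrow> bool" where
  "conv_in_distr M X N Y \<longleftrightarrow>
     (\<forall>n\<ge>1. X n \<in> borel_measurable M) \<and> Y \<in> borel_measurable N \<and>
     (\<forall>f::'b \<Rightarrow> real. continuous_on UNIV f \<and> bounded (range f) \<longrightarrow>
        (\<lambda>n. \<integral>\<omega>. f (X n \<omega>) \<partial>M) \<longlonglongrightarrow> (\<integral>\<omega>. f (Y \<omega>) \<partial>N))"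

definition wot_conv_in_distr ::
  "'w measure \<Rightarrow> (nat \<Rightarrow> 'w \<Rightarrow> 'a::euclidean_space L2 \<Rightarrow> 'a L2) \<Rightarrow>
   'v measure \<Rightarrow> ('v \<Rightarrow> 'a L2 \<Rightarrow> 'a L2) \<Rightarrow> bool" where
  "wot_conv_in_distr M R N R' \<longleftrightarrow>
     (\<forall>A. bounded_clinear A \<longrightarrow>
        conv_in_distr M (\<lambda>n \<omega>. op_trace (R n \<omega> \<circ> A)) N (\<lambda>\<omega>. op_trace (R' \<omega> \<circ> A)))"

definition has_covariance_matrix ::
  "'w measure \<Rightarrow> ('w \<Rightarrow> real^'n) \<Rightarrow> real^'n^'n \<Rightarrow> bool" where
  "has_covariance_matrix M X \<Sigma> \<longleftrightarrow>
     X \<in> borel_measurable M \<and> integrable M (\<lambda>\<omega>. (norm (X \<omega>))\<^sup>2) \<and>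
     (\<forall>i j. \<Sigma> $ i $ j =
        (\<integral>\<omega>. (X \<omega> $ i - (\<integral>\<omega>'. X \<omega>' $ i \<partial>M)) * (X \<omega> $ j - (\<integral>\<omega>'. X \<omega>' $ j \<partial>M)) \<partial>M))"

definition normal_law :: "real \<Rightarrow> real \<Rightarrow> real measure" where
  "normal_law m v = (if v = 0 then return borel m else density lborel (normal_density m (sqrt v)))"

text \<open>A vector is Gaussian if all its linear functionals are univariate normal, point masses
  included; the covariance matrix is thus allowed to be singular.\<close>

definition gaussian_vector ::
  "'w measure \<Rightarrow> ('w \<Rightarrow> real^'n) \<Rightarrow> real^'n \<Rightarrow> real^'n^'n \<Rightarrow> bool" where
  "gaussian_vector M X m \<Sigma> \<longleftrightarrow>
     X \<in> borel_measurable M \<and>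
     (\<forall>t. distr M borel (\<lambda>\<omega>. t \<bullet> X \<omega>) = normal_law (t \<bullet> m) (t \<bullet> (\<Sigma> *v t)))"

end

theory Submission
  imports Defs
begin

text \<open>The trace of \<open>\<rho>[w] A\<close> is \<open>\<langle>w, A w\<rangle>\<close>, and the shifts compose to the single shift \<open>S\<^bsub>X\<^esub>\<close> by
  \<open>X = (\<xi>\<^sub>1 + \<dots> + \<xi>\<^sub>n) / \<surd>n\<close>. Since translations act strongly continuously on \<open>L\<^sub>2\<close>, the function
  \<open>a \<mapsto> \<langle>S\<^sub>a u, A S\<^sub>a u\<rangle>\<close> is bounded and continuous, so both claims are instances of the
  multivariate central limit theorem. The latter follows from the one-dimensional one, which gives
  convergence of the expectations of all characters and hence of trigonometric polynomials. A bounded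
  continuous \<open>F\<close> is replaced by a periodic function with period of order \<open>L\<close>, at the cost of an error
  \<open>O(\<bar>x\<bar>\<^sup>2 / L\<^sup>2)\<close> that is controlled by second moments, and the periodic function is approximated
  uniformly by trigonometric polynomials (Stone--Weierstrass).\<close>

section \<open>Completeness of \<open>L\<^sub>2\<close>\<close>

lemma abs_L2_cases:
  fixes u :: "'a::euclidean_space L2"
  obtains f where "square_integrable f" "u = abs_L2 f"
  using Quotient3_rep_reflp[OF Quotient3_L2, of u] Quotient3_abs_rep[OF Quotient3_L2, of u]
  by (auto simp: L2_rel_def)

lemma L2_rel_refl [simp]: "L2_rel f f \<longleftrightarrow> square_integrable f"
  by (auto simp: L2_rel_def)

lemma square_integrable_diff:
  assumes "square_integrable f" "square_integrable g"
  shows "square_integrable (\<lambda>x. f x - g x)"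
  using square_integrable_add[OF assms(1) square_integrable_scale[OF assms(2), of "-1"]] by simp

lemma abs_L2_diff:
  assumes "square_integrable f" "square_integrable g"
  shows "abs_L2 f - abs_L2 g = abs_L2 (\<lambda>x. f x - g x)"
  using assms square_integrable_scale[of g "-1"]
  by (simp add: minus_L2_def uminus_L2_def scaleC.abs_eq plus_L2.abs_eq)

lemma norm_abs_L2:
  assumes "square_integrable f"
  shows "(norm (abs_L2 f))\<^sup>2 = (\<integral>x. (cmod (f x))\<^sup>2 \<partial>lborel)"
  using assms by (simp add: dot_square_norm[symmetric] inner_L2_def cinner.abs_eq cinner_self)

text \<open>For nonnegative integrals, the exchange with infinite sums and Fatou's lemma need no
  prior integrability; both are used for completeness.\<close>

lemma nn_integral_cmod_square_eq_norm:
  assumes "square_integrable f"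
  shows "(\<integral>\<^sup>+x. ennreal ((cmod (f x))\<^sup>2) \<partial>lborel) = ennreal ((norm (abs_L2 f))\<^sup>2)"
  using assms
  by (simp add: norm_abs_L2 nn_integral_eq_integral square_integrable_def)

text \<open>Pointwise \<open>2 \<bar>d\<^sub>i\<bar> \<le> 2\<^sup>-\<^sup>i + 2\<^sup>i \<bar>d\<^sub>i\<bar>\<^sup>2\<close>, which reduces summability to an \<open>L\<^sub>1\<close> statement
  and avoids Minkowski's inequality.\<close>

lemma AE_summable_weighted:
  fixes d :: "nat \<Rightarrow> 'a::euclidean_space \<Rightarrow> complex"
  assumes sq: "\<And>i. square_integrable (d i)"
    and small: "\<And>i. norm (abs_L2 (d i)) \<le> (1/2) ^ i"
  shows "AE x in lborel. summable (\<lambda>i. d i x)"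
proof -
  have [measurable]: "d i \<in> borel_measurable borel" for i
    using sq[of i] by (simp add: square_integrable_def)
  let ?h = "\<lambda>i x. 2 ^ i * (cmod (d i x))\<^sup>2"
  have "(\<integral>\<^sup>+x. (\<Sum>i. ennreal (?h i x)) \<partial>lborel) = (\<Sum>i. \<integral>\<^sup>+x. ennreal (?h i x) \<partial>lborel)"
    by (rule nn_integral_suminf) measurable
  also have "\<dots> \<le> (\<Sum>i. ennreal ((1/2) ^ i))"
  proof (rule suminf_le)
    fix i
    have "(\<integral>\<^sup>+x. ennreal (?h i x) \<partial>lborel) = ennreal (2 ^ i) * ennreal ((norm (abs_L2 (d i)))\<^sup>2)"
      by (simp add: ennreal_mult nn_integral_cmult nn_integral_cmod_square_eq_norm[OF sq])
    also have "\<dots> = ennreal (2 ^ i * (norm (abs_L2 (d i)))\<^sup>2)"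
      by (simp add: ennreal_mult)
    also have "\<dots> \<le> ennreal (2 ^ i * ((1/2) ^ i)\<^sup>2)"
      using small[of i] by (intro ennreal_leI mult_left_mono power_mono) auto
    also have "2 ^ i * ((1/2) ^ i)\<^sup>2 = (1/2::real) ^ i"
      by (simp add: power2_eq_square power_one_over)
    finally show "(\<integral>\<^sup>+x. ennreal (?h i x) \<partial>lborel) \<le> ennreal ((1/2) ^ i)" .
  qed auto
  also have "\<dots> = ennreal (\<Sum>i. (1/2) ^ i)"
    by (rule suminf_ennreal2) (auto intro: summable_geometric)
  also have "\<dots> < \<infinity>" by simp
  finally have "(\<integral>\<^sup>+x. (\<Sum>i. ennreal (?h i x)) \<partial>lborel) \<noteq> \<infinity>" by simp
  then have "AE x in lborel. (\<Sum>i. ennreal (?h i x)) \<noteq> \<infinity>"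
    by (intro nn_integral_PInf_AE) auto
  then show ?thesis
  proof (rule AE_mp, intro AE_I2 impI)
    fix x
    assume "(\<Sum>i. ennreal (?h i x)) \<noteq> \<infinity>"
    then have h: "summable (\<lambda>i. ?h i x)"
      by (intro summable_suminf_not_top) auto
    show "summable (\<lambda>i. d i x)"
    proof (rule summable_norm_cancel, rule summable_comparison_test')
      show "summable (\<lambda>i. (1/2) ^ i + ?h i x)"
        by (intro summable_add h summable_geometric) simp
      fix i :: nat
      have "0 \<le> 2 ^ i * (cmod (d i x) - (1/2) ^ i)\<^sup>2" by simp
      also have "\<dots> = ?h i x + (1/2) ^ i - 2 * cmod (d i x)"
      proof -
        have "(2::real) ^ i * (1/2) ^ i = 1" by (simp add: power_one_over)
        then show ?thesis by (simp add: power2_eq_square algebra_simps)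
      qed
      finally have "cmod (d i x) \<le> (1/2) ^ i + ?h i x"
        using norm_ge_zero[of "d i x"] by linarith
      then show "norm (norm (d i x)) \<le> (1/2) ^ i + ?h i x" by simp
    qed
  qed
qed

text \<open>Riesz--Fischer: a subsequence with increments below \<open>(1/2) ^ i\<close> in norm
  converges almost everywhere by the preceding lemma, and Fatou's lemma shows that the pointwise
  limit is also its limit in norm.\<close>

instance L2 :: (euclidean_space) banach
proof
  fix X :: "nat \<Rightarrow> 'a L2"
  assume X: "Cauchy X"
  have "\<exists>N. \<forall>m\<ge>N. \<forall>n\<ge>N. norm (X m - X n) < (1/2) ^ i" for i
    using CauchyD[OF X, of "(1/2) ^ i"] by simp
  then obtain N where N: "\<And>i m n. m \<ge> N i \<Longrightarrow> n \<ge> N i \<Longrightarrow> norm (X m - X n) < (1/2) ^ i"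
    by metis
  \<comment> \<open>The sum makes \<open>r i\<close> at least \<open>N i\<close>, and the summand
    \<open>i\<close> makes \<open>r\<close> strictly increasing.\<close>
  define r where "r i = (\<Sum>j\<le>i. N j) + i" for i
  have r: "strict_mono r"
    by (rule strict_monoI_Suc) (simp add: r_def)
  have "N i \<le> r i" for i
    unfolding r_def by (rule order_trans[OF member_le_sum[of i "{..i}" N]]) auto
  then have r_ge: "n \<le> m \<Longrightarrow> r m \<ge> N n" for n m
    using strict_mono_mono[OF r] by (meson monoD order_trans)
  have close: "norm (X (r m) - X (r n)) < (1/2) ^ n" if "n \<le> m" for m n
    using that by (intro N r_ge) auto
  have "\<exists>f. square_integrable f \<and> X (r i) = abs_L2 f" for i
    by (metis abs_L2_cases)
  then obtain f where f: "\<And>i. square_integrable (f i)" "\<And>i. X (r i) = abs_L2 (f i)"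
    by metis
  have [measurable]: "f i \<in> borel_measurable borel" for i
    using f(1)[of i] by (simp add: square_integrable_def)
  \<comment> \<open>Where the sequence diverges, \<open>lim\<close> has an unspecified value;
    \<open>g\<close> is Borel nevertheless, and these points will form a null set.\<close>
  define g where "g x = lim (\<lambda>i. f i x)" for x
  have [measurable]: "g \<in> borel_measurable borel"
    unfolding g_def by measurable
  have "AE x in lborel. summable (\<lambda>i. f (Suc i) x - f i x)"
  proof (rule AE_summable_weighted)
    show "norm (abs_L2 (\<lambda>x. f (Suc i) x - f i x)) \<le> (1/2) ^ i" for i
      using close[of i "Suc i"] by (simp add: f abs_L2_diff)
  qed (intro square_integrable_diff f)
  then have conv: "AE x in lborel. (\<lambda>i. f i x) \<longlonglongrightarrow> g x"
  proof (rule AE_mp, intro AE_I2 impI)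
    fix x
    assume "summable (\<lambda>i. f (Suc i) x - f i x)"
    then have "convergent (\<lambda>n. \<Sum>i<n. f (Suc i) x - f i x)"
      by (simp add: summable_iff_convergent)
    then have "convergent (\<lambda>n. f n x - f 0 x)"
      by (simp add: sum_lessThan_telescope[of "\<lambda>i. f i x"])
    then have "convergent (\<lambda>n. (f n x - f 0 x) + f 0 x)"
      by (intro convergent_add convergent_const)
    then show "(\<lambda>i. f i x) \<longlonglongrightarrow> g x"
      by (simp add: g_def convergent_LIMSEQ_iff)
  qed
  \<comment> \<open>Fatou's lemma in \<open>m\<close> with \<open>n\<close> fixed:
    \<open>X (r m) - X (r n)\<close> has norm below \<open>(1/2) ^ n\<close> as soon as
    \<open>m\<close> is at least \<open>n\<close>.\<close>
  have bound: "(\<integral>\<^sup>+x. ennreal ((cmod (g x - f n x))\<^sup>2) \<partial>lborel) \<le> ennreal (((1/2) ^ n)\<^sup>2)" for n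
  proof -
    have "(\<integral>\<^sup>+x. ennreal ((cmod (g x - f n x))\<^sup>2) \<partial>lborel)
        = (\<integral>\<^sup>+x. liminf (\<lambda>m. ennreal ((cmod (f m x - f n x))\<^sup>2)) \<partial>lborel)"
      using conv
    proof (intro nn_integral_cong_AE, elim AE_mp, intro AE_I2 impI)
      fix x
      assume "(\<lambda>i. f i x) \<longlonglongrightarrow> g x"
      then have "(\<lambda>m. ennreal ((cmod (f m x - f n x))\<^sup>2)) \<longlonglongrightarrow> ennreal ((cmod (g x - f n x))\<^sup>2)"
        by (intro tendsto_intros)
      then show "ennreal ((cmod (g x - f n x))\<^sup>2)
          = liminf (\<lambda>m. ennreal ((cmod (f m x - f n x))\<^sup>2))"
        by (intro lim_imp_Liminf[symmetric]) auto
    qed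
    also have "\<dots> \<le> liminf (\<lambda>m. \<integral>\<^sup>+x. ennreal ((cmod (f m x - f n x))\<^sup>2) \<partial>lborel)"
      by (rule nn_integral_liminf) measurable
    also have "\<dots> = liminf (\<lambda>m. ennreal ((norm (X (r m) - X (r n)))\<^sup>2))"
      by (simp add: nn_integral_cmod_square_eq_norm square_integrable_diff f abs_L2_diff)
    also have "\<dots> \<le> liminf (\<lambda>m. ennreal (((1/2) ^ n)\<^sup>2))"
    proof (rule Liminf_mono)
      show "\<forall>\<^sub>F m in sequentially.
          ennreal ((norm (X (r m) - X (r n)))\<^sup>2) \<le> ennreal (((1/2) ^ n)\<^sup>2)"
        using eventually_ge_at_top[of n]
        by eventually_elim (intro ennreal_leI power_mono less_imp_le[OF close] norm_ge_zero)
    qed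
    finally show ?thesis by (simp add: Liminf_const)
  qed
  have gf: "square_integrable (\<lambda>x. g x - f n x)" for n
    unfolding square_integrable_def
  proof (intro conjI integrableI_nonneg)
    show "(\<integral>\<^sup>+x. ennreal ((cmod (g x - f n x))\<^sup>2) \<partial>lborel) < \<infinity>"
      using bound[of n] by (rule le_less_trans) simp
  qed auto
  have g: "square_integrable g"
    using square_integrable_add[OF gf[of 0] f(1)[of 0]] by simp
  have le: "norm (X (r n) - abs_L2 g) \<le> (1/2) ^ n" for n
  proof -
    have "ennreal ((norm (abs_L2 g - X (r n)))\<^sup>2) \<le> ennreal (((1/2) ^ n)\<^sup>2)"
      using bound[of n] gf[of n] by (simp add: nn_integral_cmod_square_eq_norm f g abs_L2_diff)
    then have "(norm (abs_L2 g - X (r n)))\<^sup>2 \<le> ((1/2) ^ n)\<^sup>2"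
      by (simp only: ennreal_le_iff zero_le_power2)
    then have "norm (abs_L2 g - X (r n)) \<le> (1/2) ^ n"
      by (rule power2_le_imp_le) simp
    then show ?thesis by (simp add: norm_minus_commute)
  qed
  have "(\<lambda>n. X (r n)) \<longlonglongrightarrow> abs_L2 g"
  proof (rule LIM_zero_cancel, rule Lim_null_comparison)
    show "\<forall>\<^sub>F n in sequentially. norm (X (r n) - abs_L2 g) \<le> (1/2) ^ n"
      using le by simp
  qed (simp add: LIMSEQ_power_zero)
  then show "convergent X"
    using Cauchy_converges_subseq[OF X r] by (auto simp: o_def convergent_def)
qed

section \<open>Orthonormal bases and the trace\<close>

lemma mult_cnj_cmod: "z * cnj z = (complex_of_real (cmod z))\<^sup>2"
  by (simp add: complex_norm_square[symmetric])

lemma cinner_scaleC_left: "cinner (scaleC c v) u = cnj c * cinner v u"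
  by (metis cinner_commute cinner_scaleC_right complex_cnj_mult)

lemma cinner_scaleR_right: "cinner u (r *\<^sub>R v) = r *\<^sub>R cinner u v"
  by (simp add: scaleR_L2_def cinner_scaleC_right scaleR_conv_of_real)

lemma cinner_self_norm: "cinner u u = complex_of_real ((norm u)\<^sup>2)"
proof -
  have "Im (cinner u u) = 0"
    using cinner_commute[of u u] by (metis Reals_cnj_iff complex_is_Real_iff)
  moreover have "Re (cinner u u) = (norm u)\<^sup>2"
    using dot_square_norm[of u] by (simp add: inner_L2_def)
  ultimately show ?thesis by (simp add: complex_eq_iff)
qed

lemma norm_scaleC: "norm (scaleC c v) = cmod c * norm v"
proof (rule power2_eq_imp_eq)
  have "complex_of_real ((norm (scaleC c v))\<^sup>2) = complex_of_real ((cmod c * norm v)\<^sup>2)"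
    unfolding cinner_self_norm[symmetric] cinner_scaleC_left cinner_scaleC_right
    by (simp add: cinner_self_norm power_mult_distrib mult_cnj_cmod mult.assoc[symmetric])
  then show "(norm (scaleC c v))\<^sup>2 = (cmod c * norm v)\<^sup>2"
    by (simp only: of_real_eq_iff)
qed auto

text \<open>The Cauchy--Schwarz inequality of \<open>real_inner\<close> controls only the real part
  of \<open>cinner\<close>. Multiplying \<open>v\<close> by a suitable \<open>c\<close> of modulus
  one makes the complex inner product real and nonnegative without changing the norm of
  \<open>v\<close>.\<close>

lemma norm_cinner_le: "cmod (cinner u v) \<le> norm u * norm v"
proof -
  obtain c where c: "cmod c = 1" "c * cinner u v = complex_of_real (cmod (cinner u v))"
  proof (cases "cinner u v = 0")
    case False
    show ?thesis
      by (rule that[of "cnj (cinner u v) / of_real (cmod (cinner u v))"])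
        (use False in \<open>simp_all add: norm_divide mult_cnj_cmod power2_eq_square
          mult.commute[of "cnj _"]\<close>)
  qed (auto intro: that[of 1])
  have "cmod (cinner u v) = inner u (scaleC c v)"
    using c by (simp add: inner_L2_def cinner_scaleC_right)
  also have "\<dots> \<le> norm u * norm (scaleC c v)" by (rule norm_cauchy_schwarz)
  finally show ?thesis by (simp add: norm_scaleC c)
qed

lemma bounded_linear_cinner_right: "bounded_linear (cinner u)"
  by (rule bounded_linear_intro[where K = "norm u"])
    (simp_all add: cinner_add_right cinner_scaleR_right norm_cinner_le mult.commute[of "norm _" "norm u"])

lemma cinner_diff_right: "cinner u (v - w) = cinner u v - cinner u w"
  by (rule linear_diff[OF bounded_linear.linear[OF bounded_linear_cinner_right]])

lemma cinner_diff_left: "cinner (v - w) u = cinner v u - cinner w u"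
  by (metis cinner_commute cinner_diff_right complex_cnj_diff)

lemma cinner_sum_right: "cinner u (sum f F) = (\<Sum>x\<in>F. cinner u (f x))"
  by (rule linear_sum[OF bounded_linear.linear[OF bounded_linear_cinner_right]])

text \<open>Split off from \<open>orthonormal_basis\<close> as the property to which Zorn's lemma is
  applied.\<close>

definition orthonormal :: "'a::euclidean_space L2 set \<Rightarrow> bool" where
  "orthonormal B \<longleftrightarrow> (\<forall>e\<in>B. \<forall>f\<in>B. cinner e f = (if e = f then 1 else 0))"

lemma orthonormal_basis_iff:
  "orthonormal_basis B \<longleftrightarrow> orthonormal B \<and> (\<forall>v. (\<forall>e\<in>B. cinner e v = 0) \<longrightarrow> v = 0)"
  by (simp add: orthonormal_basis_def orthonormal_def)

text \<open>This enlargement contradicts maximality in the existence proof below.\<close>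

lemma orthonormal_insert:
  assumes B: "orthonormal B" and v: "v \<noteq> 0" "\<And>e. e \<in> B \<Longrightarrow> cinner e v = 0"
  shows "orthonormal (insert (v /\<^sub>R norm v) B)"
proof -
  have "cinner e (v /\<^sub>R norm v) = 0" "cinner (v /\<^sub>R norm v) e = 0" if "e \<in> B" for e
    using v(2)[OF that] cinner_commute[of "v /\<^sub>R norm v" e] by (simp_all add: cinner_scaleR_right)
  moreover have "cinner (v /\<^sub>R norm v) (v /\<^sub>R norm v) = 1"
    using v(1) by (simp add: cinner_self_norm)
  ultimately show ?thesis
    using B unfolding orthonormal_def by auto
qed

text \<open>Zorn's lemma gives a maximal orthonormal set, and a nonzero vector orthogonal to it
  could be normalised and added. If no basis existed, the condition in \<open>op_trace\<close> would
  be vacuous and would not determine a value.\<close>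

lemma orthonormal_basis_exists: "\<exists>B::'a::euclidean_space L2 set. orthonormal_basis B"
proof -
  have "\<exists>B\<in>Collect orthonormal. \<forall>B'\<in>Collect orthonormal. B \<subseteq> B' \<longrightarrow> B' = (B::'a L2 set)"
  proof (rule subset_Zorn')
    fix C :: "'a L2 set set"
    assume C: "subset.chain (Collect orthonormal) C"
    have "cinner e f = (if e = f then 1 else 0)" if "e \<in> X" "f \<in> Y" "X \<in> C" "Y \<in> C" for e f X Y
    proof -
      have "X \<subseteq> Y \<or> Y \<subseteq> X" "orthonormal X" "orthonormal Y"
        using C that unfolding subset.chain_def by auto
      then show ?thesis using that unfolding orthonormal_def by blast
    qed
    then show "\<Union>C \<in> Collect orthonormal"
      unfolding orthonormal_def by blast
  qed
  then obtain B :: "'a L2 set" where B: "orthonormal B"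
    and max: "\<And>B'. orthonormal B' \<Longrightarrow> B \<subseteq> B' \<Longrightarrow> B' = B" by auto
  have "v = 0" if v: "\<forall>e\<in>B. cinner e v = 0" for v
  proof (rule ccontr)
    assume "v \<noteq> 0"
    then have "insert (v /\<^sub>R norm v) B = B"
      using v by (intro max orthonormal_insert B) auto
    then have "cinner (v /\<^sub>R norm v) v = 0" using v by blast
    then have "cnj (cinner (v /\<^sub>R norm v) v) = 0" by simp
    then have "cinner v (v /\<^sub>R norm v) = 0"
      using cinner_commute by metis
    then show False using \<open>v \<noteq> 0\<close> by (simp add: cinner_scaleR_right cinner_self_norm)
  qed
  then show ?thesis using B by (auto simp: orthonormal_basis_iff)
qed

text \<open>Pythagoras: pairing the sum with one of its basis vectors isolates a single
  coefficient.\<close>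

lemma norm_square_orthonormal_sum:
  assumes "orthonormal B" "finite F" "F \<subseteq> B"
  shows "(norm (\<Sum>e\<in>F. scaleC (c e) e))\<^sup>2 = (\<Sum>e\<in>F. (cmod (c e))\<^sup>2)"
proof -
  let ?P = "\<Sum>e\<in>F. scaleC (c e) e"
  have *: "cinner e ?P = c e" if "e \<in> F" for e
  proof -
    have "cinner e ?P = (\<Sum>f\<in>F. c f * (if e = f then 1 else 0))"
      unfolding cinner_sum_right cinner_scaleC_right
      using assms(1) subsetD[OF assms(3)] that
      by (intro sum.cong refl arg_cong2[where f = "(*)"]) (auto simp: orthonormal_def)
    then show ?thesis using that assms(2) by (simp add: if_distrib cong: if_cong)
  qed
  have "cinner ?P ?P = (\<Sum>e\<in>F. c e * cinner ?P e)"
    by (simp only: cinner_sum_right cinner_scaleC_right)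
  also have "\<dots> = (\<Sum>e\<in>F. c e * cnj (c e))"
  proof (intro sum.cong refl arg_cong2[where f = "(*)"])
    fix e assume "e \<in> F"
    then show "cinner ?P e = cnj (c e)"
      by (simp add: cinner_commute[of ?P e] *)
  qed
  finally have "complex_of_real ((norm ?P)\<^sup>2) = complex_of_real (\<Sum>e\<in>F. (cmod (c e))\<^sup>2)"
    by (simp add: cinner_self_norm mult_cnj_cmod)
  then show ?thesis by (simp only: of_real_eq_iff)
qed

text \<open>The squared distance from \<open>w\<close> to its projection \<open>?P\<close> is
  \<open>(norm w)\<^sup>2\<close> minus the sum of the squared coefficients, and it is
  nonnegative.\<close>

lemma bessel:
  assumes "orthonormal B" "finite F" "F \<subseteq> B"
  shows "(\<Sum>e\<in>F. (cmod (cinner e w))\<^sup>2) \<le> (norm w)\<^sup>2"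
proof -
  let ?P = "\<Sum>e\<in>F. scaleC (cinner e w) e"
  have "cinner w ?P = (\<Sum>e\<in>F. cinner e w * cnj (cinner e w))"
    unfolding cinner_sum_right cinner_scaleC_right
    by (intro sum.cong refl arg_cong2[where f = "(*)"]) (rule cinner_commute)
  also have "\<dots> = complex_of_real (\<Sum>e\<in>F. (cmod (cinner e w))\<^sup>2)"
    by (simp add: mult_cnj_cmod)
  finally have "inner w ?P = (\<Sum>e\<in>F. (cmod (cinner e w))\<^sup>2)"
    by (simp add: inner_L2_def)
  moreover have "0 \<le> (norm (w - ?P))\<^sup>2" by simp
  moreover have "(norm (w - ?P))\<^sup>2 = (norm w)\<^sup>2 - 2 * inner w ?P + (norm ?P)\<^sup>2"
    by (simp add: power2_norm_eq_inner inner_diff_left inner_diff_right inner_commute)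
  ultimately show ?thesis
    using norm_square_orthonormal_sum[OF assms, of "\<lambda>e. cinner e w"] by simp
qed

text \<open>Bessel's inequality makes the squared coefficients summable. By Pythagoras they control
  the differences of partial sums, so the net of sums over finite subsets is Cauchy, and
  completeness provides its limit.\<close>

lemma orthonormal_summable_on:
  assumes B: "orthonormal B"
  shows "(\<lambda>e. scaleC (cinner e w) e) summable_on B"
proof -
  let ?c = "\<lambda>e. (cmod (cinner e w))\<^sup>2" and ?f = "\<lambda>e. scaleC (cinner e w) e"
  have "?c summable_on B"
    by (rule nonneg_bdd_above_summable_on)
      (auto intro!: bdd_aboveI2[where M = "(norm w)\<^sup>2"] bessel[OF B])
  then obtain s where s: "(?c has_sum s) B" by (auto simp: summable_on_def)
  have "\<exists>P. eventually P (finite_subsets_at_top B) \<and>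
            (\<forall>F F'. P F \<and> P F' \<longrightarrow> dist (sum ?f F) (sum ?f F') < \<epsilon>)" if "\<epsilon> > 0" for \<epsilon>
  proof -
    \<comment> \<open>Two coefficient sums this close to \<open>s\<close> differ by less than
      \<open>(\<epsilon>/2)\<^sup>2\<close>, so for nested index sets the vector sums differ by less
      than \<open>\<epsilon>/2\<close> in norm. Comparing both sums with the one over
      \<open>F0\<close> then costs less than \<open>\<epsilon>\<close>.\<close>
    have "\<forall>\<^sub>F F in finite_subsets_at_top B. dist (sum ?c F) s < (\<epsilon>/2)\<^sup>2 / 2"
      by (rule tendstoD[OF s[unfolded has_sum_def]]) (use that in simp)
    then obtain F0 where F0: "finite F0" "F0 \<subseteq> B"
      and close: "\<forall>F. finite F \<and> F0 \<subseteq> F \<and> F \<subseteq> B \<longrightarrow> dist (sum ?c F) s < (\<epsilon>/2)\<^sup>2 / 2"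
      by (simp only: eventually_finite_subsets_at_top) (elim exE conjE)
    define P where "P F \<longleftrightarrow> finite F \<and> F0 \<subseteq> F \<and> F \<subseteq> B" for F
    have "eventually P (finite_subsets_at_top B)"
      using F0 by (auto simp: eventually_finite_subsets_at_top P_def)
    moreover have *: "dist (sum ?f F) (sum ?f F0) < \<epsilon>/2" if "P F" for F
    proof -
      have F: "finite F" "F0 \<subseteq> F" "F \<subseteq> B" using that by (auto simp: P_def)
      have "(dist (sum ?f F) (sum ?f F0))\<^sup>2 = (norm (sum ?f (F - F0)))\<^sup>2"
        using F by (simp add: dist_norm sum_diff)
      also have "\<dots> = sum ?c (F - F0)"
        using F by (intro norm_square_orthonormal_sum[OF B]) auto
      also have "\<dots> = sum ?c F - sum ?c F0"
        using F by (simp add: sum_diff)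
      also have "\<dots> < (\<epsilon>/2)\<^sup>2"
        using close[rule_format, OF conjI[OF F(1) conjI[OF F(2,3)]]]
          close[rule_format, OF conjI[OF F0(1) conjI[OF order_refl F0(2)]]]
        unfolding dist_real_def by linarith
      finally show ?thesis
        by (rule power2_less_imp_less) (use \<open>\<epsilon> > 0\<close> in auto)
    qed
    moreover have "dist (sum ?f F) (sum ?f F') < \<epsilon>" if "P F" "P F'" for F F'
      using dist_triangle2[of "sum ?f F" "sum ?f F'" "sum ?f F0"] *[OF that(1)] *[OF that(2)]
      by linarith
    ultimately show ?thesis by blast
  qed
  then have "cauchy_filter (filtermap (sum ?f) (finite_subsets_at_top B))"
    by (simp add: cauchy_filter_metric_filtermap)
  moreover have "uniform_space_class.complete (UNIV::'a L2 set)"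
    by (meson Cauchy_convergent UNIV_I complete_def convergent_def)
  ultimately obtain L where "(sum ?f \<longlongrightarrow> L) (finite_subsets_at_top B)"
    using complete_uniform[where S=UNIV] by (force simp add: filterlim_def)
  then show ?thesis
    using summable_on_def has_sum_def by blast
qed

text \<open>The sum of the series has the same coefficients as \<open>w\<close>, so the difference
  is orthogonal to \<open>B\<close> and vanishes because \<open>B\<close> is a basis.\<close>

lemma orthonormal_basis_expansion:
  assumes "orthonormal_basis B"
  shows "((\<lambda>e. scaleC (cinner e w) e) has_sum w) B"
proof -
  have B: "orthonormal B" using assms by (simp add: orthonormal_basis_iff)
  obtain s where s: "((\<lambda>e. scaleC (cinner e w) e) has_sum s) B"
    using orthonormal_summable_on[OF B] by (auto simp: summable_on_def)
  have "cinner f (w - s) = 0" if f: "f \<in> B" for f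
  proof -
    have "((\<lambda>e. cinner f (scaleC (cinner e w) e)) has_sum cinner f s) B"
      by (rule has_sum_bounded_linear[OF bounded_linear_cinner_right s])
    moreover have "((\<lambda>e. cinner f (scaleC (cinner e w) e)) has_sum cinner f w) B"
    proof (rule has_sum_finite_neutralI)
      show "cinner f (scaleC (cinner e w) e) = 0" if "e \<in> B - {f}" for e
        using B f that by (auto simp: orthonormal_def cinner_scaleC_right)
      show "cinner f w = (\<Sum>e\<in>{f}. cinner f (scaleC (cinner e w) e))"
        using B f by (simp add: orthonormal_def cinner_scaleC_right)
    qed (use f in auto)
    ultimately have "cinner f s = cinner f w" by (rule has_sum_unique)
    then show ?thesis by (simp add: cinner_diff_right)
  qed
  then have "w - s = 0" using assms unfolding orthonormal_basis_iff by blast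
  then show ?thesis using s by simp
qed

text \<open>The bounded functional \<open>\<lambda>v. cinner w (A v)\<close>, applied to the
  expansion of \<open>w\<close>, turns it term by term into the trace series; complex linearity of
  \<open>A\<close> is what lets the coefficients pass through. The sum is the same for all bases,
  and the existence of one makes it unique.\<close>

theorem op_trace_pure_state:
  assumes A: "bounded_clinear A"
  shows "op_trace (pure_state w \<circ> A) = cinner w (A w)"
proof -
  have lin: "bounded_linear (\<lambda>v. cinner w (A v))"
    using A by (intro bounded_linear_compose[OF bounded_linear_cinner_right])
      (simp add: bounded_clinear_def)
  have *: "((\<lambda>e. cinner e ((pure_state w \<circ> A) e)) has_sum cinner w (A w)) B"
    if "orthonormal_basis B" for B
    using has_sum_bounded_linear[OF lin orthonormal_basis_expansion[OF that, of w]] A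
    by (simp add: pure_state_def cinner_scaleC_right bounded_clinear_def mult.commute)
  obtain B where B: "orthonormal_basis (B :: 'a L2 set)"
    using orthonormal_basis_exists by blast
  show ?thesis
    unfolding op_trace_def
    by (rule the_equality) (use * B has_sum_unique in blast)+
qed

section \<open>Continuity of translations\<close>

lemma shift_op_abs_L2:
  "square_integrable f \<Longrightarrow> shift_op a (abs_L2 f) = abs_L2 (\<lambda>x. f (x + a))"
  by (simp add: shift_op.abs_eq)

lemma shift_op_shift_op: "shift_op a (shift_op b u) = shift_op (a + b) u"
proof transfer
  fix a b :: 'a and f :: "'a \<Rightarrow> complex"
  assume "L2_rel f f"
  then show "L2_rel (\<lambda>x. f (x + a + b)) (\<lambda>x. f (x + (a + b)))"
    using square_integrable_shift[of f "a + b"] by (simp add: add.assoc)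
qed

lemma shift_op_zero [simp]: "shift_op 0 u = u"
  by transfer auto

lemma shift_prod_eq: "shift_prod n a u = shift_op (\<Sum>k=1..n. a k) u"
proof -
  have "foldr (\<lambda>k. shift_op (a k)) ks u = shift_op (\<Sum>k\<leftarrow>ks. a k) u" for ks
    by (induction ks) (simp_all add: shift_op_shift_op)
  then show ?thesis
    by (simp add: shift_prod_def sum_list_distinct_conv_sum_set atLeastLessThanSuc_atLeastAtMost del: upt_Suc)
qed

lemma shift_op_diff: "shift_op a (u - v) = shift_op a u - shift_op a v"
proof -
  obtain f g where "square_integrable f" "u = abs_L2 f" "square_integrable g" "v = abs_L2 g"
    by (metis abs_L2_cases)
  then show ?thesis
    by (simp add: abs_L2_diff shift_op_abs_L2 square_integrable_diff square_integrable_shift)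
qed

lemma norm_shift_op [simp]: "norm (shift_op a u) = norm u"
proof -
  obtain f where f: "square_integrable f" "u = abs_L2 f"
    by (metis abs_L2_cases)
  then have [measurable]: "f \<in> borel_measurable borel" by (simp add: square_integrable_def)
  have "(norm (shift_op a u))\<^sup>2 = (\<integral>x. (cmod (f (a + x)))\<^sup>2 \<partial>lborel)"
    using f by (simp add: shift_op_abs_L2 norm_abs_L2 square_integrable_shift add.commute)
  also have "\<dots> = (\<integral>x. (cmod (f x))\<^sup>2 \<partial>distr lborel borel ((+) a))"
    by (subst integral_distr) auto
  also have "\<dots> = (norm u)\<^sup>2"
    using f by (simp add: lborel_distr_plus norm_abs_L2)
  finally show ?thesis by (simp add: power2_eq_iff_nonneg)
qed

section \<open>Dominated convergence in \<open>L2\<close> and density of continuous functions of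
  bounded support\<close>

lemma tendsto_L2_dominated:
  fixes f :: "nat \<Rightarrow> 'a::euclidean_space \<Rightarrow> complex"
  assumes sq: "\<And>n. square_integrable (f n)" "square_integrable g"
    and lim: "AE x in lborel. (\<lambda>n. f n x) \<longlonglongrightarrow> g x"
    and dom: "integrable lborel w" "\<And>n. AE x in lborel. (cmod (f n x - g x))\<^sup>2 \<le> w x"
  shows "(\<lambda>n. abs_L2 (f n)) \<longlonglongrightarrow> abs_L2 g"
proof -
  have [measurable]: "f n \<in> borel_measurable borel" "g \<in> borel_measurable borel" for n
    using sq by (simp_all add: square_integrable_def)
  have "(\<lambda>n. \<integral>x. (cmod (f n x - g x))\<^sup>2 \<partial>lborel) \<longlonglongrightarrow> (\<integral>x. 0 \<partial>(lborel :: 'a measure))"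
  proof (rule integral_dominated_convergence[where w = w])
    show "AE x in lborel. (\<lambda>n. (cmod (f n x - g x))\<^sup>2) \<longlonglongrightarrow> 0"
      using lim
    proof eventually_elim
      fix x
      assume "(\<lambda>n. f n x) \<longlonglongrightarrow> g x"
      then have "(\<lambda>n. (cmod (f n x - g x))\<^sup>2) \<longlonglongrightarrow> (cmod (g x - g x))\<^sup>2"
        by (intro tendsto_intros)
      then show "(\<lambda>n. (cmod (f n x - g x))\<^sup>2) \<longlonglongrightarrow> 0" by simp
    qed
    show "AE x in lborel. norm ((cmod (f n x - g x))\<^sup>2) \<le> w x" for n
      using dom(2)[of n] by eventually_elim simp
  qed (use dom in auto)
  then have "(\<lambda>n. (norm (abs_L2 (f n) - abs_L2 g))\<^sup>2) \<longlonglongrightarrow> 0"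
    by (simp add: abs_L2_diff sq norm_abs_L2 square_integrable_diff)
  then have "(\<lambda>n. sqrt ((norm (abs_L2 (f n) - abs_L2 g))\<^sup>2)) \<longlonglongrightarrow> sqrt 0"
    by (rule tendsto_real_sqrt)
  then show ?thesis
    by (simp add: tendsto_norm_zero_iff LIM_zero_iff)
qed

lemma square_integrable_bounded_support:
  fixes f :: "'a::euclidean_space \<Rightarrow> complex"
  assumes [measurable]: "f \<in> borel_measurable borel"
    and bound: "\<And>x. cmod (f x) \<le> C * indicator (cball 0 r) x"
  shows "square_integrable f"
  unfolding square_integrable_def
proof
  show "integrable lborel (\<lambda>x. (cmod (f x))\<^sup>2)"
  proof (rule Bochner_Integration.integrable_bound)
    show "integrable lborel (\<lambda>x::'a. C\<^sup>2 * indicator (cball 0 r) x :: real)"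
      by (intro integrable_mult_right) (auto intro!: integrable_real_indicator simp: emeasure_lborel_cball_finite[unfolded infinity_ennreal_def])
    show "AE x in lborel. norm ((cmod (f x))\<^sup>2) \<le> norm (C\<^sup>2 * indicator (cball 0 r) x :: real)"
    proof (rule AE_I2)
      fix x
      have "(cmod (f x))\<^sup>2 \<le> (C * indicator (cball 0 r) x)\<^sup>2"
        by (intro power_mono bound) simp
      then show "norm ((cmod (f x))\<^sup>2) \<le> norm (C\<^sup>2 * indicator (cball 0 r) x :: real)"
        by (cases "x \<in> cball 0 r") (simp_all add: power_mult_distrib)
    qed
  qed measurable
qed simp

text \<open>The multiple of an indicator encodes boundedness and bounded support at once, in the
  form in which dominated convergence uses them.\<close>

definition L2_compact_support :: "'a::euclidean_space L2 set" where
  "L2_compact_support = {abs_L2 f | f. continuous_on UNIV f \<and>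
     (\<exists>C r. \<forall>x. cmod (f x) \<le> C * indicator (cball 0 r) x)}"

text \<open>A ball has finite measure, so a constant on it dominates the squared differences. This
  serves both the continuous approximations and the translates below.\<close>

lemma bounded_support_tendsto:
  fixes f :: "nat \<Rightarrow> 'a::euclidean_space \<Rightarrow> complex"
  assumes [measurable]: "\<And>n. f n \<in> borel_measurable borel" "g \<in> borel_measurable borel"
    and bound: "\<And>n x. cmod (f n x) \<le> C * indicator (cball 0 r) x"
      "\<And>x. cmod (g x) \<le> C * indicator (cball 0 r) x"
    and lim: "AE x in lborel. (\<lambda>n. f n x) \<longlonglongrightarrow> g x"
  shows "(\<lambda>n. abs_L2 (f n)) \<longlonglongrightarrow> abs_L2 g"
proof (rule tendsto_L2_dominated[where w = "\<lambda>x. (2 * C)\<^sup>2 * indicator (cball 0 r) x"])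
  show "integrable lborel (\<lambda>x::'a. (2 * C)\<^sup>2 * indicator (cball 0 r) x :: real)"
    by (intro integrable_mult_right) (auto intro!: integrable_real_indicator simp: emeasure_lborel_cball_finite[unfolded infinity_ennreal_def])
  show "AE x in lborel. (cmod (f n x - g x))\<^sup>2 \<le> (2 * C)\<^sup>2 * indicator (cball 0 r) x" for n
  proof (rule AE_I2)
    fix x
    have "cmod (f n x - g x) \<le> cmod (f n x) + cmod (g x)" by (rule norm_triangle_ineq4)
    also have "\<dots> \<le> 2 * C * indicator (cball 0 r) x"
      using bound(1)[of n x] bound(2)[of x] by simp
    finally have "(cmod (f n x - g x))\<^sup>2 \<le> (2 * C * indicator (cball 0 r) x)\<^sup>2"
      by (intro power_mono) auto
    then show "(cmod (f n x - g x))\<^sup>2 \<le> (2 * C)\<^sup>2 * indicator (cball 0 r) x"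
      by (cases "x \<in> cball 0 r") (simp_all add: power_mult_distrib)
  qed
qed (use assms square_integrable_bounded_support in blast)+

text \<open>Two approximations: a square-integrable function is the limit of its truncations in both
  argument and value, and each truncation is the limit of continuous functions with a common bound
  and a common bounded support.\<close>

lemma L2_compact_support_dense: "closure L2_compact_support = (UNIV :: 'a::euclidean_space L2 set)"
proof -
  let ?V = "closure L2_compact_support :: 'a L2 set"
  have bdd: "abs_L2 f \<in> ?V"
    if [measurable]: "f \<in> borel_measurable borel"
      and f: "\<And>x. cmod (f x) \<le> real m * indicator (cball 0 (real m)) x" for f :: "'a \<Rightarrow> complex" and m
  proof -
    \<comment> \<open>This gives continuous \<open>g n\<close> converging to \<open>f\<close> off a
      null set, but with neither a common bound nor a common support; both are enforced by
      \<open>h\<close>.\<close>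
    have "f measurable_on UNIV"
      by (intro lebesgue_measurable_imp_measurable_on measurable_completion) auto
    then obtain N g where N: "negligible N" and g: "\<And>n. continuous_on UNIV (g n)"
      and lim: "\<And>x. x \<notin> N \<Longrightarrow> (\<lambda>n. g n x) \<longlonglongrightarrow> f x"
      unfolding measurable_on_def by auto
    define cut where "cut x = max 0 (min 1 (real m + 1 - norm x))" for x :: 'a
    define K where "K = max 1 (real m)"
    \<comment> \<open>The inner factor retracts the complex plane radially onto the disc of radius
      \<open>K\<close>, and \<open>cut\<close> is 1 on the ball of radius \<open>m\<close> and 0
      outside that of radius \<open>m + 1\<close>. Both operations are continuous and leave
      \<open>f\<close> unchanged. Taking \<open>K\<close> at least 1 keeps the denominator positive
      for \<open>m = 0\<close>.\<close>
    define h where "h n x = cut x *\<^sub>R ((K / max K (cmod (g n x))) *\<^sub>R g n x)" for n x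
    have K: "K \<ge> 1" "K \<ge> real m" by (simp_all add: K_def)
    have cont: "continuous_on UNIV (h n)" for n
      unfolding h_def cut_def by (intro continuous_intros g) (use K in \<open>auto simp: max_def\<close>)
    have hb: "cmod (h n x) \<le> K * indicator (cball 0 (real m + 1)) x" for n x
    proof -
      have "K / max K (cmod (g n x)) * cmod (g n x) \<le> K"
        using K by (simp add: divide_le_eq max_def mult_left_mono)
      moreover have "0 \<le> cut x" "cut x \<le> indicator (cball 0 (real m + 1)) x"
        by (auto simp: cut_def indicator_def)
      ultimately have "cut x * (K / max K (cmod (g n x)) * cmod (g n x)) \<le> indicator (cball 0 (real m + 1)) x * K"
        using K by (intro mult_mono) auto
      then show ?thesis using K \<open>0 \<le> cut x\<close> by (simp add: h_def ac_simps)
    qed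
    have "(\<lambda>n. abs_L2 (h n)) \<longlonglongrightarrow> abs_L2 f"
    proof (rule bounded_support_tendsto[where C = K and r = "real m + 1"])
      show "cmod (f x) \<le> K * indicator (cball 0 (real m + 1)) x" for x
        using f[of x] K by (cases "x \<in> cball 0 (real m)") (auto simp: indicator_def)
      have "AE x in lborel. x \<notin> N"
        using N AE_not_in[of N lebesgue] by (simp add: negligible_iff_null_sets AE_completion_iff)
      then show "AE x in lborel. (\<lambda>n. h n x) \<longlonglongrightarrow> f x"
      proof eventually_elim
        fix x assume "x \<notin> N"
        then have "(\<lambda>n. h n x) \<longlonglongrightarrow> cut x *\<^sub>R ((K / max K (cmod (f x))) *\<^sub>R f x)"
          unfolding h_def by (intro tendsto_intros lim) (use K in \<open>auto simp: max_def\<close>)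
        moreover have "max K (cmod (f x)) = K"
          using f[of x] K by (cases "x \<in> cball 0 (real m)") (auto simp: indicator_def)
        moreover have "cut x *\<^sub>R f x = f x"
          using f[of x] by (cases "x \<in> cball 0 (real m)") (auto simp: cut_def)
        ultimately show "(\<lambda>n. h n x) \<longlonglongrightarrow> f x" using K by simp
      qed
      show "h n \<in> borel_measurable borel" for n
        by (rule borel_measurable_continuous_onI[OF cont])
    qed (use hb in auto)
    moreover have "abs_L2 (h n) \<in> L2_compact_support" for n
      unfolding L2_compact_support_def using cont hb by blast
    ultimately show ?thesis
      unfolding closure_sequential by (intro exI[of _ "\<lambda>n. abs_L2 (h n)"]) auto
  qed
  have "u \<in> ?V" for u
  proof -
    obtain f where f: "square_integrable f" "u = abs_L2 f" by (metis abs_L2_cases)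
    then have [measurable]: "f \<in> borel_measurable borel" by (simp add: square_integrable_def)
    define t where "t m x = (if norm x \<le> real m \<and> cmod (f x) \<le> real m then f x else 0)" for m x
    have [measurable]: "t m \<in> borel_measurable borel" for m
      unfolding t_def by measurable
    have tb: "cmod (t m x) \<le> real m * indicator (cball 0 (real m)) x" for m x
      by (auto simp: t_def indicator_def)
    have "(\<lambda>m. abs_L2 (t m)) \<longlonglongrightarrow> u"
      unfolding f(2)
    proof (rule tendsto_L2_dominated[where w = "\<lambda>x. (cmod (f x))\<^sup>2"])
      show "square_integrable (t m)" for m
        by (rule square_integrable_bounded_support[OF _ tb]) measurable
      show "AE x in lborel. (\<lambda>m. t m x) \<longlonglongrightarrow> f x"
      proof (intro AE_I2 tendsto_eventually)
        fix x
        show "\<forall>\<^sub>F m in sequentially. t m x = f x"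
          using eventually_ge_at_top[of "nat \<lceil>max (norm x) (cmod (f x))\<rceil>"]
          by eventually_elim (auto simp: t_def nat_ceiling_le_eq)
      qed
      show "AE x in lborel. (cmod (t m x - f x))\<^sup>2 \<le> (cmod (f x))\<^sup>2" for m
        by (auto simp: t_def)
    qed (use f in \<open>auto simp: square_integrable_def\<close>)
    moreover have "abs_L2 (t m) \<in> ?V" for m
      using tb by (intro bdd) measurable
    ultimately have "u \<in> closure ?V"
      unfolding closure_sequential[of u ?V] by (intro exI[of _ "\<lambda>m. abs_L2 (t m)"]) auto
    then show ?thesis by simp
  qed
  then show ?thesis by blast
qed

text \<open>Continuity of the representative gives pointwise convergence. The shifts are bounded by
  some \<open>L\<close>, so all translates are supported in the ball of radius \<open>r + L\<close>,
  and the convergence is dominated.\<close>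

lemma shift_op_tendsto_compact_support:
  fixes u :: "'a::euclidean_space L2"
  assumes u: "u \<in> L2_compact_support" and a: "a \<longlonglongrightarrow> 0"
  shows "(\<lambda>n. shift_op (a n) u) \<longlonglongrightarrow> u"
proof -
  obtain f C r where f: "u = abs_L2 f" "continuous_on UNIV f"
    "\<And>x. cmod (f x) \<le> C * indicator (cball 0 r) x"
    using u unfolding L2_compact_support_def by blast
  have [measurable]: "f \<in> borel_measurable borel"
    using f(2) by (rule borel_measurable_continuous_onI)
  obtain L where L: "\<And>n. norm (a n) \<le> L"
    using convergent_imp_Bseq[OF convergentI[OF a]] unfolding Bseq_def by blast
  \<comment> \<open>At the origin a negative \<open>C\<close> is compatible with the bound only if
    the ball is empty.\<close>
  have C: "C \<ge> 0 \<or> r < 0"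
    using f(3)[of 0] order_trans[OF norm_ge_zero f(3)[of 0]] by (auto simp: indicator_def split: if_splits)
  have mono: "C * indicator (cball 0 r) x \<le> max 0 C * (indicator (cball 0 (r + L)) y :: real)"
    if "norm (x - y) \<le> L" for x y :: 'a
    using that norm_triangle_ineq2[of y x] C
    by (auto simp: indicator_def norm_minus_commute max_def)
  have sq: "square_integrable f"
    by (rule square_integrable_bounded_support[OF _ f(3)]) measurable
  have "L \<ge> 0" using order_trans[OF norm_ge_zero L] .
  have "(\<lambda>n. abs_L2 (\<lambda>x. f (x + a n))) \<longlonglongrightarrow> abs_L2 f"
  proof (rule bounded_support_tendsto[where C = "max 0 C" and r = "r + L"])
    show "cmod (f (x + a n)) \<le> max 0 C * indicator (cball 0 (r + L)) x" for n x
      using L[of n] by (intro order_trans[OF f(3) mono]) simp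
    show "cmod (f x) \<le> max 0 C * indicator (cball 0 (r + L)) x" for x
      using \<open>L \<ge> 0\<close> by (intro order_trans[OF f(3) mono]) simp
    show "AE x in lborel. (\<lambda>n. f (x + a n)) \<longlonglongrightarrow> f x"
    proof (rule AE_I2)
      fix x
      have "(\<lambda>n. x + a n) \<longlonglongrightarrow> x + 0" by (intro tendsto_intros a)
      then have "(\<lambda>n. f (x + a n)) \<longlonglongrightarrow> f (x + 0)"
        by (rule continuous_on_tendsto_compose[OF f(2)]) auto
      then show "(\<lambda>n. f (x + a n)) \<longlonglongrightarrow> f x" by simp
    qed
  qed measurable
  then show ?thesis using sq by (simp add: f(1) shift_op_abs_L2)
qed

text \<open>Translations are isometries, so an \<epsilon>/3 argument extends continuity at 0 from
  the dense set to every \<open>u\<close>. Continuity at \<open>b\<close> reduces to this, since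
  \<open>shift_op b\<close> maps \<open>shift_op (a - b) u - u\<close> to
  \<open>shift_op a u - shift_op b u\<close>.\<close>

lemma continuous_shift_op:
  fixes u :: "'a::euclidean_space L2"
  shows "continuous_on UNIV (\<lambda>a. shift_op a u)"
proof -
  have "(\<lambda>n. shift_op (a n) u) \<longlonglongrightarrow> u" if a: "a \<longlonglongrightarrow> 0" for a
  proof (rule LIMSEQ_I)
    fix \<epsilon> :: real assume "\<epsilon> > 0"
    obtain v where v: "v \<in> L2_compact_support" "dist v u < \<epsilon>/3"
      using L2_compact_support_dense \<open>\<epsilon> > 0\<close> closure_approachable[of u L2_compact_support]
      by (metis UNIV_I zero_less_divide_iff zero_less_numeral)
    obtain N where N: "\<And>n. n \<ge> N \<Longrightarrow> norm (shift_op (a n) v - v) < \<epsilon>/3"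
      using LIMSEQ_D[OF shift_op_tendsto_compact_support[OF v(1) a], of "\<epsilon>/3"] \<open>\<epsilon> > 0\<close> by auto
    have "norm (shift_op (a n) u - u) < \<epsilon>" if "n \<ge> N" for n
    proof -
      have "shift_op (a n) u - u = shift_op (a n) (u - v) + (shift_op (a n) v - v) + (v - u)"
        by (simp add: shift_op_diff)
      also have "norm \<dots> \<le> norm (shift_op (a n) (u - v)) + norm (shift_op (a n) v - v) + norm (v - u)"
        by (meson norm_triangle_ineq order_trans add_right_mono)
      also have "\<dots> < \<epsilon>"
        using N[OF that] v(2) by (simp add: dist_norm norm_minus_commute)
      finally show ?thesis .
    qed
    then show "\<exists>N. \<forall>n\<ge>N. norm (shift_op (a n) u - u) < \<epsilon>" by blast
  qed note at0 = this
  show ?thesis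
    unfolding continuous_on_sequentially
  proof (intro allI ballI impI, elim conjE)
    fix a :: "nat \<Rightarrow> 'a" and b
    assume "a \<longlonglongrightarrow> b"
    then have "(\<lambda>n. shift_op (a n - b) u) \<longlonglongrightarrow> u"
      by (intro at0 LIM_zero)
    then have "(\<lambda>n. norm (shift_op (a n - b) u - u)) \<longlonglongrightarrow> 0"
      by (intro tendsto_norm_zero LIM_zero)
    moreover have "norm (shift_op (a n - b) u - u) = norm (shift_op (a n) u - shift_op b u)" for n
    proof -
      have "shift_op (a n) u - shift_op b u = shift_op b (shift_op (a n - b) u - u)"
        by (simp add: shift_op_diff shift_op_shift_op)
      then show ?thesis by simp
    qed
    ultimately show "((\<lambda>a. shift_op a u) \<circ> a) \<longlonglongrightarrow> shift_op b u"
      unfolding o_def by (simp add: tendsto_norm_zero_iff LIM_zero_iff)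
  qed
qed

text \<open>The two arguments of \<open>cinner\<close> are varied one at a time: the change in the
  first is small by Cauchy--Schwarz, the change in the second by continuity of the functional
  \<open>cinner (shift_op b u)\<close>.\<close>

lemma continuous_cinner_shift_op:
  fixes u :: "'a::euclidean_space L2"
  assumes A: "bounded_clinear A"
  shows "continuous_on UNIV (\<lambda>a. cinner (shift_op a u) (A (shift_op a u)))"
proof -
  have A: "bounded_linear A" using A by (simp add: bounded_clinear_def)
  have *: "isCont (\<lambda>a. shift_op a u) b" for b
    using continuous_shift_op[of u] by (simp add: continuous_on_eq_continuous_at)
  have "((\<lambda>a. cinner (shift_op a u) (A (shift_op a u))) \<longlongrightarrow> cinner (shift_op b u) (A (shift_op b u))) (at b)" for b
  proof -
    have 1: "((\<lambda>a. shift_op a u - shift_op b u) \<longlongrightarrow> 0) (at b)"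
      using * unfolding isCont_def by (rule LIM_zero)
    have 2: "((\<lambda>a. A (shift_op a u)) \<longlongrightarrow> A (shift_op b u)) (at b)"
      using *[of b] unfolding isCont_def by (rule bounded_linear.tendsto[OF A])
    have "((\<lambda>a. cinner (shift_op a u - shift_op b u) (A (shift_op a u))) \<longlongrightarrow> 0) (at b)"
    proof (rule Lim_null_comparison)
      show "((\<lambda>a. norm (shift_op a u - shift_op b u) * norm (A (shift_op a u))) \<longlongrightarrow> 0) (at b)"
        using tendsto_mult[OF tendsto_norm_zero[OF 1] tendsto_norm[OF 2]] by simp
    qed (simp add: norm_cinner_le)
    moreover have "((\<lambda>a. cinner (shift_op b u) (A (shift_op a u))) \<longlongrightarrow> cinner (shift_op b u) (A (shift_op b u))) (at b)"
      by (rule bounded_linear.tendsto[OF bounded_linear_cinner_right 2])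
    ultimately show ?thesis
      using tendsto_add by (fastforce simp: cinner_diff_left)
  qed
  then show ?thesis by (simp add: continuous_on_def)
qed

text \<open>Translations preserve the norm. Boundedness allows the trace itself to be used as a test
  function, which yields the convergence of expectations.\<close>

lemma bounded_cinner_shift_op:
  assumes A: "bounded_clinear A"
  shows "bounded (range (\<lambda>a. cinner (shift_op a u) (A (shift_op a u))))"
proof -
  obtain K where K: "\<And>v. norm (A v) \<le> norm v * K"
    using A bounded_linear.bounded[of A] by (auto simp: bounded_clinear_def)
  have "cmod (cinner (shift_op a u) (A (shift_op a u))) \<le> norm u * (norm u * K)" for a
    using K[of "shift_op a u"] by (intro order_trans[OF norm_cinner_le]) (simp add: mult_left_mono)
  then show ?thesis by (auto simp: bounded_iff)
qed

section \<open>Convergence of characters and weak convergence\<close>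

inductive trig_poly :: "('a::real_inner \<Rightarrow> complex) \<Rightarrow> bool" where
  character: "trig_poly (\<lambda>x. c * cis (t \<bullet> x))"
| add: "trig_poly p \<Longrightarrow> trig_poly q \<Longrightarrow> trig_poly (\<lambda>x. p x + q x)"

lemma trig_poly_const: "trig_poly (\<lambda>x. c)"
  using trig_poly.character[of c 0] by simp

text \<open>The product of two characters is the character of the sum of the frequencies. Closure
  under products is what brings polynomials on the torus into the class.\<close>

lemma trig_poly_mult:
  assumes "trig_poly p" "trig_poly q"
  shows "trig_poly (\<lambda>x. p x * q x)"
  using assms
proof (induction rule: trig_poly.induct)
  case (character c t)
  from \<open>trig_poly q\<close> show ?case
  proof (induction rule: trig_poly.induct)
    case (character d s)
    have "(\<lambda>x. c * cis (t \<bullet> x) * (d * cis (s \<bullet> x))) = (\<lambda>x. (c * d) * cis ((t + s) \<bullet> x))"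
      by (simp add: inner_add_left ac_simps flip: cis_mult)
    then show ?case using trig_poly.character[of "c * d" "t + s"] by simp
  next
    case (add p q)
    then show ?case by (simp add: distrib_left trig_poly.add)
  qed
next
  case (add p1 p2)
  then show ?case by (simp add: distrib_right trig_poly.add)
qed

lemma trig_poly_sum:
  "finite I \<Longrightarrow> (\<And>i. i \<in> I \<Longrightarrow> trig_poly (p i)) \<Longrightarrow> trig_poly (\<lambda>x. \<Sum>i\<in>I. p i x)"
  by (induction rule: finite_induct) (simp_all add: trig_poly_const trig_poly.add)

lemma trig_poly_cos: "trig_poly (\<lambda>x. complex_of_real (cos (t \<bullet> x)))"
proof -
  have "(\<lambda>x. complex_of_real (cos (t \<bullet> x))) = (\<lambda>x. 1/2 * cis (t \<bullet> x) + 1/2 * cis ((- t) \<bullet> x))"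
    by (auto simp: complex_eq_iff)
  then show ?thesis
    using trig_poly.add[OF trig_poly.character[of "1/2" t] trig_poly.character[of "1/2" "- t"]] by simp
qed

lemma trig_poly_sin: "trig_poly (\<lambda>x. complex_of_real (sin (t \<bullet> x)))"
proof -
  have "(\<lambda>x. complex_of_real (sin (t \<bullet> x))) = (\<lambda>x. - \<i>/2 * cis (t \<bullet> x) + \<i>/2 * cis ((- t) \<bullet> x))"
    by (auto simp: complex_eq_iff)
  then show ?thesis
    using trig_poly.add[OF trig_poly.character[of "- \<i>/2" t] trig_poly.character[of "\<i>/2" "- t"]] by simp
qed

text \<open>Wraps space around the torus with period \<open>2 * pi * L\<close> in each
  coordinate.\<close>

definition torus_map :: "real \<Rightarrow> real^'n \<Rightarrow> complex^'n" where
  "torus_map L x = (\<chi> j. cis (x $ j / L))"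

text \<open>The real coordinates of \<open>torus_map L x\<close> are cosines and sines with
  frequency \<open>axis j (1 / L)\<close>; a linear functional is a combination of them, and sums
  and products stay in the class.\<close>

lemma trig_poly_polynomial:
  fixes p :: "complex^'n \<Rightarrow> real"
  assumes "real_polynomial_function p"
  shows "trig_poly (\<lambda>x. complex_of_real (p (torus_map L x)))"
  using assms
proof (induction rule: real_polynomial_function.induct)
  case (linear f)
  have f: "f z = (\<Sum>b\<in>Basis. f b * (z \<bullet> b))" for z
  proof -
    have "f z = f (\<Sum>b\<in>Basis. (z \<bullet> b) *\<^sub>R b)" by (simp add: euclidean_representation)
    also have "\<dots> = (\<Sum>b\<in>Basis. (z \<bullet> b) *\<^sub>R f b)"
      using bounded_linear.linear[OF linear] by (simp add: linear_sum linear_scale)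
    finally show ?thesis by (simp add: mult.commute)
  qed
  have "trig_poly (\<lambda>x. complex_of_real (torus_map L x \<bullet> b))" if b_in: "b \<in> Basis" for b :: "complex^'n"
  proof -
    obtain j v where b: "b = axis j v" "v \<in> {1, \<i>}"
      using b_in unfolding Basis_vec_def Basis_complex_def by blast
    have *: "axis j (1 / L) \<bullet> x = x $ j / L" for x :: "real^'n"
      by (simp add: inner_axis')
    show ?thesis
    proof (cases "v = 1")
      case True
      then show ?thesis
        using trig_poly_cos[of "axis j (1 / L)"] b
        by (simp add: inner_axis torus_map_def * inner_complex_def)
    next
      case False
      then show ?thesis
        using trig_poly_sin[of "axis j (1 / L)"] b
        by (simp add: inner_axis torus_map_def * inner_complex_def)
    qed
  qed
  then have "trig_poly (\<lambda>x. \<Sum>b\<in>Basis. complex_of_real (f b) * complex_of_real (torus_map L x \<bullet> b))"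
    by (intro trig_poly_sum trig_poly_mult trig_poly_const) auto
  then show ?case by (simp only: f[of "torus_map L _"] of_real_sum of_real_mult)
next
  case (add f g)
  then show ?case by (simp add: trig_poly.add)
next
  case (mult f g)
  then show ?case by (simp add: trig_poly_mult)
qed (simp add: trig_poly_const)

lemma trig_poly_continuous: "trig_poly p \<Longrightarrow> continuous_on UNIV p"
  by (induction rule: trig_poly.induct) (auto simp: cis.ctr Complex_eq intro!: continuous_intros)

lemma trig_poly_bounded: "trig_poly p \<Longrightarrow> \<exists>K. \<forall>x. cmod (p x) \<le> K"
proof (induction rule: trig_poly.induct)
  case (character c t)
  then show ?case by (intro exI[of _ "cmod c"]) (simp add: norm_mult)
next
  case (add p q)
  then obtain K1 K2 where "\<forall>x. cmod (p x) \<le> K1" "\<forall>x. cmod (q x) \<le> K2" by blast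
  then have "\<forall>x. cmod (p x + q x) \<le> K1 + K2"
    by (meson add_mono norm_triangle_ineq order_trans)
  then show ?case by blast
qed

lemma trig_poly_integrable:
  fixes p :: "'a::euclidean_space \<Rightarrow> complex"
  assumes "prob_space M" "X \<in> borel_measurable M" "trig_poly p"
  shows "integrable M (\<lambda>\<omega>. p (X \<omega>))"
proof -
  interpret prob_space M by fact
  obtain K where "\<forall>x. cmod (p x) \<le> K" using trig_poly_bounded[OF assms(3)] by blast
  then show ?thesis
    using borel_measurable_continuous_onI[OF trig_poly_continuous[OF assms(3)]] assms(2)
    by (intro integrable_const_bound[where B = K] measurable_compose[of X M borel p borel]) auto
qed

lemma trig_poly_expectation_tendsto:
  fixes X :: "nat \<Rightarrow> 'w \<Rightarrow> 'a::euclidean_space"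
  assumes M: "prob_space M" "\<And>n. X n \<in> borel_measurable M"
    and N: "prob_space N" "Y \<in> borel_measurable N"
    and char: "\<And>t. (\<lambda>n. \<integral>\<omega>. cis (t \<bullet> X n \<omega>) \<partial>M) \<longlonglongrightarrow> (\<integral>\<omega>. cis (t \<bullet> Y \<omega>) \<partial>N)"
    and p: "trig_poly p"
  shows "(\<lambda>n. \<integral>\<omega>. p (X n \<omega>) \<partial>M) \<longlonglongrightarrow> (\<integral>\<omega>. p (Y \<omega>) \<partial>N)"
  using p
proof (induction rule: trig_poly.induct)
  case (character c t)
  show ?case using tendsto_mult_left[OF char, of c t] by simp
next
  case (add p q)
  then show ?case
    using tendsto_add[OF add.IH] by (simp add: trig_poly_integrable M N)
qed

section \<open>Periodisation of a bounded continuous function\<close>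

lemma one_minus_cos_le: "1 - cos y \<le> y\<^sup>2 / 2" for y :: real
proof -
  have "1 - cos y = 2 * (sin (y/2))\<^sup>2"
    using cos_double_sin[of "y/2"] by simp
  also have "(sin (y/2))\<^sup>2 \<le> (y/2)\<^sup>2"
    using abs_sin_x_le_abs_x[of "y/2"] by (simp only: abs_le_square_iff)
  finally show ?thesis by (simp add: power2_eq_square)
qed

text \<open>Composed with the torus map, this is \<open>F\<close> times a product of cosines on the cube
  \<open>\<bar>x\<^sub>j\<bar> \<le> L \<pi> / 2\<close>; \<open>arcsin\<close> makes it continuous on the torus without a case distinction.\<close>

definition periodise :: "real \<Rightarrow> (real^'n \<Rightarrow> real) \<Rightarrow> complex^'n \<Rightarrow> real" where
  "periodise L F z = F (\<chi> j. L * arcsin (Im (z $ j))) * (\<Prod>j\<in>UNIV. max 0 (Re (z $ j)))"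

definition torus :: "(complex^'n) set" where
  "torus = {z. \<forall>j. cmod (z $ j) = 1}"

lemma torus_map_in_torus: "torus_map L x \<in> torus"
  by (simp add: torus_map_def torus_def)

lemma compact_torus: "compact (torus :: (complex^'n) set)"
proof (rule compact_eq_bounded_closed[THEN iffD2], intro conjI)
  have "norm z \<le> real CARD('n)" if "z \<in> torus" for z :: "complex^'n"
    using norm_le_l1_cart[of "\<chi> j. cmod (z $ j)"] that
    by (simp add: torus_def norm_vec_def L2_set_def)
  then show "bounded (torus :: (complex^'n) set)" by (auto simp: bounded_iff)
  show "closed (torus :: (complex^'n) set)"
    unfolding torus_def by (intro closed_Collect_all closed_Collect_eq continuous_intros)
qed

text \<open>On the torus the imaginary parts lie between -1 and 1, where \<open>arcsin\<close> is
  continuous.\<close>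

lemma continuous_periodise:
  fixes F :: "real^'n \<Rightarrow> real"
  assumes "continuous_on UNIV F"
  shows "continuous_on torus (periodise L F)"
proof -
  have "\<bar>Im (z $ j)\<bar> \<le> 1" if "z \<in> torus" for z :: "complex^'n" and j
    using that abs_Im_le_cmod[of "z $ j"] by (simp add: torus_def)
  then have *: "- 1 \<le> Im (z $ j) \<and> Im (z $ j) \<le> 1" if "z \<in> torus" for z :: "complex^'n" and j
    using that by (fastforce simp: abs_le_iff)
  have "continuous_on torus (\<lambda>z::complex^'n. \<chi> j. L * arcsin (Im (z $ j)))"
    by (intro continuous_intros) (use * in auto)
  then have "continuous_on torus (\<lambda>z::complex^'n. F (\<chi> j. L * arcsin (Im (z $ j))))"
    by (rule continuous_on_compose2[OF assms]) auto
  then show ?thesis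
    unfolding periodise_def by (intro continuous_intros) auto
qed

text \<open>Inside the cube \<open>arcsin\<close> recovers the point, and the product of cosines
  falls short of 1 by at most the sum of the \<open>1 - cos (y j)\<close>, which is quadratic in
  \<open>x / L\<close>. Outside, some \<open>y j\<close> exceeds 1 in modulus, so the trivial bound
  \<open>2 * C\<close> is already of the required form.\<close>

lemma periodise_approx:
  fixes F :: "real^'n \<Rightarrow> real"
  assumes C: "\<And>x. \<bar>F x\<bar> \<le> C" and L: "L > 0"
  shows "\<bar>F x - periodise L F (torus_map L x)\<bar> \<le> 2 * C * (norm x)\<^sup>2 / L\<^sup>2"
proof -
  define y where "y j = x $ j / L" for j
  have C0: "C \<ge> 0" using C[of 0] by linarith
  have sumy: "(\<Sum>j\<in>UNIV. (y j)\<^sup>2) = (norm x)\<^sup>2 / L\<^sup>2"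
    by (simp add: y_def norm_vec_def L2_set_def sum_nonneg power_divide sum_divide_distrib)
  have P: "periodise L F (torus_map L x)
      = F (\<chi> j. L * arcsin (sin (y j))) * (\<Prod>j\<in>UNIV. max 0 (cos (y j)))"
    by (simp add: periodise_def torus_map_def y_def)
  show ?thesis
  proof (cases "\<forall>j. \<bar>y j\<bar> \<le> pi / 2")
    case True
    have cos0: "0 \<le> cos (y j)" for j
      using True[rule_format, of j] by (intro cos_ge_zero) auto
    have "arcsin (sin (y j)) = y j" for j
      using True[rule_format, of j] by (intro arcsin_sin) linarith+
    then have "(\<chi> j. L * arcsin (sin (y j))) = x"
      using L by (simp add: vec_eq_iff y_def)
    then have "F x - periodise L F (torus_map L x) = F x * (1 - (\<Prod>j\<in>UNIV. cos (y j)))"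
      unfolding P using cos0 by (simp add: algebra_simps max_def)
    also have "\<bar>\<dots>\<bar> \<le> C * (\<Sum>j\<in>UNIV. 1 - cos (y j))"
      unfolding abs_mult
    proof (intro mult_mono C C0)
      have "(\<Prod>j\<in>UNIV. cos (y j)) \<le> 1" by (intro prod_le_1) (auto simp: cos0)
      moreover have "1 - (\<Sum>j\<in>UNIV. 1 - cos (y j)) \<le> (\<Prod>j\<in>UNIV. 1 - (1 - cos (y j)))"
        by (rule Weierstrass_prod_ineq) (auto simp: cos0)
      ultimately show "\<bar>1 - (\<Prod>j\<in>UNIV. cos (y j))\<bar> \<le> (\<Sum>j\<in>UNIV. 1 - cos (y j))" by simp
    qed simp
    also have "\<dots> \<le> C * (\<Sum>j\<in>UNIV. (y j)\<^sup>2 / 2)"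
      by (intro mult_left_mono sum_mono one_minus_cos_le C0)
    \<comment> \<open>The constant is enlarged to 2 only to agree with the other case.\<close>
    also have "\<dots> \<le> C * (2 * (\<Sum>j\<in>UNIV. (y j)\<^sup>2))"
      unfolding sum_distrib_left by (intro mult_left_mono sum_mono C0) auto
    finally show ?thesis by (simp add: sumy ac_simps)
  next
    case False
    then obtain j where j: "\<bar>y j\<bar> > pi / 2" by (auto simp: not_le)
    then have "1 \<le> \<bar>y j\<bar>" using pi_ge_two by linarith
    then have "1 \<le> (y j)\<^sup>2" using power_mono[of 1 "\<bar>y j\<bar>" 2] by simp
    also have "\<dots> \<le> (\<Sum>j\<in>UNIV. (y j)\<^sup>2)" by (rule member_le_sum) auto
    finally have 1: "1 \<le> (norm x)\<^sup>2 / L\<^sup>2" by (simp only: sumy)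
    have "\<bar>periodise L F (torus_map L x)\<bar> \<le> C * 1"
      unfolding P abs_mult by (intro mult_mono C C0) (auto simp: abs_prod intro!: prod_le_1 prod_nonneg)
    then have "\<bar>F x - periodise L F (torus_map L x)\<bar> \<le> 2 * C * 1"
      using C[of x] by linarith
    also have "\<dots> \<le> 2 * C * ((norm x)\<^sup>2 / L\<^sup>2)"
      using 1 C0 by (intro mult_left_mono) auto
    finally show ?thesis by simp
  qed
qed

text \<open>The periodisation error is integrated against the second moment and the uniform
  polynomial error adds \<open>\<epsilon>\<close>. The bound depends on \<open>X\<close> only
  through \<open>S\<close>, so one polynomial serves a whole sequence and its limit.\<close>

lemma expectation_approx:
  fixes F :: "real^'n \<Rightarrow> real" and p :: "complex^'n \<Rightarrow> real"
  assumes M: "prob_space M" and X: "X \<in> borel_measurable M"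
    and F: "continuous_on UNIV F" "\<And>x. \<bar>F x\<bar> \<le> C" and L: "L > 0"
    and p: "real_polynomial_function p" "\<And>z. z \<in> torus \<Longrightarrow> \<bar>periodise L F z - p z\<bar> \<le> \<epsilon>"
    and X2: "integrable M (\<lambda>\<omega>. (norm (X \<omega>))\<^sup>2)" "(\<integral>\<omega>. (norm (X \<omega>))\<^sup>2 \<partial>M) \<le> S"
  shows "\<bar>(\<integral>\<omega>. F (X \<omega>) \<partial>M) - (\<integral>\<omega>. p (torus_map L (X \<omega>)) \<partial>M)\<bar> \<le> 2 * C * S / L\<^sup>2 + \<epsilon>"
proof -
  interpret prob_space M by fact
  have C0: "C \<ge> 0" using F(2)[of 0] by linarith
  have iF: "integrable M (\<lambda>\<omega>. F (X \<omega>))"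
    using F X borel_measurable_continuous_onI[OF F(1)]
    by (intro integrable_const_bound[where B = C] measurable_compose[of X M borel F borel]) auto
  have "integrable M (\<lambda>\<omega>. complex_of_real (p (torus_map L (X \<omega>))))"
    by (rule trig_poly_integrable[OF M X trig_poly_polynomial[OF p(1)]])
  then have ip: "integrable M (\<lambda>\<omega>. p (torus_map L (X \<omega>)))"
    by (simp only: complex_of_real_integrable_eq)
  have le: "\<bar>F x - p (torus_map L x)\<bar> \<le> (2 * C / L\<^sup>2) * (norm x)\<^sup>2 + \<epsilon>" for x
    using periodise_approx[where F = F and C = C and x = x, OF F(2) L] p(2)[OF torus_map_in_torus, of L x] by simp
  have "\<bar>(\<integral>\<omega>. F (X \<omega>) \<partial>M) - (\<integral>\<omega>. p (torus_map L (X \<omega>)) \<partial>M)\<bar>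
      = \<bar>\<integral>\<omega>. F (X \<omega>) - p (torus_map L (X \<omega>)) \<partial>M\<bar>"
    by (simp add: iF ip)
  also have "\<dots> \<le> (\<integral>\<omega>. \<bar>F (X \<omega>) - p (torus_map L (X \<omega>))\<bar> \<partial>M)"
    by (rule integral_abs_bound)
  also have "\<dots> \<le> (\<integral>\<omega>. (2 * C / L\<^sup>2) * (norm (X \<omega>))\<^sup>2 + \<epsilon> \<partial>M)"
    by (intro integral_mono) (use iF ip X2 le in auto)
  also have "\<dots> = (2 * C / L\<^sup>2) * (\<integral>\<omega>. (norm (X \<omega>))\<^sup>2 \<partial>M) + \<epsilon>"
    using X2 by (simp add: prob_space)
  also have "\<dots> \<le> (2 * C / L\<^sup>2) * S + \<epsilon>"
    using X2 C0 by (intro add_right_mono mult_left_mono) auto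
  finally show ?thesis by simp
qed

text \<open>The common second-moment bound \<open>S\<close> takes the place of tightness: first
  \<open>L\<close>, then the polynomial, and only then the index \<open>n0\<close> is
  chosen.\<close>

theorem expectation_tendsto_of_characters:
  fixes X :: "nat \<Rightarrow> 'w \<Rightarrow> real^'n" and F :: "real^'n \<Rightarrow> real"
  assumes M: "prob_space M" "\<And>n. X n \<in> borel_measurable M"
    and N: "prob_space N" "Y \<in> borel_measurable N"
    and char: "\<And>t. (\<lambda>n. \<integral>\<omega>. cis (t \<bullet> X n \<omega>) \<partial>M) \<longlonglongrightarrow> (\<integral>\<omega>. cis (t \<bullet> Y \<omega>) \<partial>N)"
    and X2: "\<And>n. integrable M (\<lambda>\<omega>. (norm (X n \<omega>))\<^sup>2)" "\<And>n. (\<integral>\<omega>. (norm (X n \<omega>))\<^sup>2 \<partial>M) \<le> S"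
    and Y2: "integrable N (\<lambda>\<omega>. (norm (Y \<omega>))\<^sup>2)" "(\<integral>\<omega>. (norm (Y \<omega>))\<^sup>2 \<partial>N) \<le> S"
    and F: "continuous_on UNIV F" "bounded (range F)"
  shows "(\<lambda>n. \<integral>\<omega>. F (X n \<omega>) \<partial>M) \<longlonglongrightarrow> (\<integral>\<omega>. F (Y \<omega>) \<partial>N)"
proof (rule LIMSEQ_I)
  fix \<epsilon> :: real assume \<epsilon>: "\<epsilon> > 0"
  obtain C where C: "\<And>x. \<bar>F x\<bar> \<le> C"
    using F(2) by (auto simp: bounded_iff)
  have "C \<ge> 0" using C[of 0] by linarith
  have "S \<ge> 0" using order_trans[OF _ X2(2)[of 0]] by simp
  \<comment> \<open>Chosen so that the periodisation error is at most \<open>\<epsilon> / 8\<close>;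
    the added 1 keeps \<open>L\<close> positive if \<open>C * S = 0\<close>.\<close>
  define L where "L = sqrt (16 * C * S / \<epsilon> + 1)"
  have L: "L > 0" "L\<^sup>2 = 16 * C * S / \<epsilon> + 1"
    using \<epsilon> \<open>C \<ge> 0\<close> \<open>S \<ge> 0\<close> by (simp_all add: L_def add_nonneg_pos)
  have small: "2 * C * S / L\<^sup>2 \<le> \<epsilon> / 8"
  proof -
    have "16 * C * S \<le> \<epsilon> * L\<^sup>2" using \<epsilon> by (simp add: L(2) field_simps)
    then show ?thesis using L(1) by (simp add: field_simps)
  qed
  obtain p where p: "real_polynomial_function p" "\<And>z. z \<in> torus \<Longrightarrow> \<bar>periodise L F z - p z\<bar> < \<epsilon> / 8"
    using Stone_Weierstrass_real_polynomial_function[OF compact_torus continuous_periodise[OF F(1), of L], of "\<epsilon> / 8"] \<epsilon>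
    by auto
  let ?p = "\<lambda>x. p (torus_map L x)"
  have "(\<lambda>n. \<integral>\<omega>. complex_of_real (?p (X n \<omega>)) \<partial>M) \<longlonglongrightarrow> (\<integral>\<omega>. complex_of_real (?p (Y \<omega>)) \<partial>N)"
    by (rule trig_poly_expectation_tendsto[OF M N char trig_poly_polynomial[OF p(1)]])
  then have "(\<lambda>n. \<integral>\<omega>. ?p (X n \<omega>) \<partial>M) \<longlonglongrightarrow> (\<integral>\<omega>. ?p (Y \<omega>) \<partial>N)"
    by (simp only: integral_complex_of_real tendsto_of_real_iff)
  then obtain n0 where n0: "\<And>n. n \<ge> n0 \<Longrightarrow> \<bar>(\<integral>\<omega>. ?p (X n \<omega>) \<partial>M) - (\<integral>\<omega>. ?p (Y \<omega>) \<partial>N)\<bar> < \<epsilon> / 8"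
    using LIMSEQ_D[of _ _ "\<epsilon> / 8"] \<epsilon> by fastforce
  \<comment> \<open>Replacing \<open>F\<close> by the polynomial costs at most
    \<open>\<epsilon> / 4\<close> on each side, and the two polynomial expectations differ by less
    than \<open>\<epsilon> / 8\<close>.\<close>
  have "\<bar>(\<integral>\<omega>. F (X n \<omega>) \<partial>M) - (\<integral>\<omega>. F (Y \<omega>) \<partial>N)\<bar> < \<epsilon>" if "n \<ge> n0" for n
    using n0[OF that] small \<epsilon>
      expectation_approx[OF M(1) M(2)[of n] F(1) C L(1) p(1) less_imp_le[OF p(2)] X2]
      expectation_approx[OF N F(1) C L(1) p(1) less_imp_le[OF p(2)] Y2]
    by linarith
  then show "\<exists>n0. \<forall>n\<ge>n0. norm ((\<integral>\<omega>. F (X n \<omega>) \<partial>M) - (\<integral>\<omega>. F (Y \<omega>) \<partial>N)) < \<epsilon>"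
    by auto
qed

section \<open>The multivariate central limit theorem\<close>

lemma borel_measurable_cis [measurable]: "cis \<in> borel_measurable borel"
  unfolding cis_conv_exp by measurable

text \<open>Passes from variables numbered from 1 to the numbering from 0 in which the
  one-dimensional central limit theorem is applied.\<close>

lemma (in prob_space) indep_vars_Suc:
  assumes "indep_vars (\<lambda>_. N) X {1..}"
  shows "indep_vars (\<lambda>_. N) (\<lambda>i. X (Suc i)) UNIV"
  unfolding indep_vars_def2
proof (intro conjI ballI indep_setsI)
  let ?F = "\<lambda>i. {X i -` A \<inter> space M |A. A \<in> sets N}"
  have X: "\<And>i. i \<ge> 1 \<Longrightarrow> random_variable N (X i)" and ind: "indep_sets ?F {1..}"
    using assms unfolding indep_vars_def2 by auto
  show "random_variable N (X (Suc i))" for i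
    using X by simp
  then show "?F (Suc i) \<subseteq> events" for i
    by (auto simp: measurable_sets)
  fix A J
  assume J: "J \<noteq> {}" "finite J" and A: "\<forall>j\<in>J. A j \<in> ?F (Suc j)"
  have "prob (\<Inter>j\<in>Suc ` J. A (j - 1)) = (\<Prod>j\<in>Suc ` J. prob (A (j - 1)))"
    using J A by (intro indep_setsD[OF ind]) auto
  then show "prob (\<Inter>j\<in>J. A j) = (\<Prod>j\<in>J. prob (A j))"
    by (simp add: prod.reindex)
qed

text \<open>Each new summand is centred and independent of the earlier sum, so the mixed term has
  expectation zero.\<close>

lemma (in prob_space) expectation_square_sum_indep:
  fixes Z :: "nat \<Rightarrow> 'a \<Rightarrow> real"
  assumes ind: "indep_vars (\<lambda>_. borel) Z UNIV"
    and mean: "\<And>i. expectation (Z i) = 0"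
    and sq: "\<And>i. integrable M (\<lambda>\<omega>. (Z i \<omega>)\<^sup>2)"
    and var: "\<And>i. expectation (\<lambda>\<omega>. (Z i \<omega>)\<^sup>2) = v"
  shows "integrable M (\<lambda>\<omega>. (\<Sum>i<n. Z i \<omega>)\<^sup>2) \<and> expectation (\<lambda>\<omega>. (\<Sum>i<n. Z i \<omega>)\<^sup>2) = real n * v"
proof (induction n)
  case (Suc n)
  have [measurable]: "random_variable borel (Z i)" for i
    using ind unfolding indep_vars_def2 by simp
  have int: "integrable M (Z i)" for i
    by (rule square_integrable_imp_integrable[OF _ sq]) simp
  have indn: "indep_var borel (Z n) borel (\<lambda>\<omega>. \<Sum>i<n. Z i \<omega>)"
    by (rule indep_vars_sum) (auto intro: indep_vars_subset[OF ind])
  have intS: "integrable M (\<lambda>\<omega>. \<Sum>i<n. Z i \<omega>)" using int by simp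
  have prod: "integrable M (\<lambda>\<omega>. Z n \<omega> * (\<Sum>i<n. Z i \<omega>))"
    "expectation (\<lambda>\<omega>. Z n \<omega> * (\<Sum>i<n. Z i \<omega>)) = 0"
    using indep_var_integrable[OF indn int intS] indep_var_lebesgue_integral[OF indn int intS] mean[of n]
    by simp_all
  have eq: "(\<lambda>\<omega>. (\<Sum>i<Suc n. Z i \<omega>)\<^sup>2)
      = (\<lambda>\<omega>. (\<Sum>i<n. Z i \<omega>)\<^sup>2 + 2 * (Z n \<omega> * (\<Sum>i<n. Z i \<omega>)) + (Z n \<omega>)\<^sup>2)"
    by (simp add: power2_eq_square algebra_simps)
  show ?case
    unfolding eq using Suc prod sq[of n] var[of n] by (simp add: algebra_simps)
qed simp

text \<open>For \<open>v > 0\<close>, the central limit theorem and Levy's continuity theorem are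
  used at the frequency \<open>sqrt v\<close>, which undoes the normalisation of the variance. For
  \<open>v = 0\<close> the sums vanish almost surely.\<close>

lemma (in prob_space) clt_characters:
  fixes Z :: "nat \<Rightarrow> 'a \<Rightarrow> real"
  assumes ind: "indep_vars (\<lambda>_. borel) Z UNIV"
    and mean: "\<And>i. expectation (Z i) = 0"
    and sq: "\<And>i. integrable M (\<lambda>\<omega>. (Z i \<omega>)\<^sup>2)"
    and var: "\<And>i. expectation (\<lambda>\<omega>. (Z i \<omega>)\<^sup>2) = v"
    and ident: "\<And>i. distr M borel (Z i) = \<mu>"
  shows "(\<lambda>n. \<integral>\<omega>. cis ((\<Sum>i<n. Z i \<omega>) / sqrt (real n)) \<partial>M) \<longlonglongrightarrow> complex_of_real (exp (- v / 2))"
proof -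
  have [measurable]: "random_variable borel (Z i)" for i
    using ind unfolding indep_vars_def2 by simp
  have "v \<ge> 0" unfolding var[of 0, symmetric] by simp
  show ?thesis
  proof (cases "v = 0")
    case True
    have zero: "AE \<omega> in M. (\<Sum>i<n. Z i \<omega>)\<^sup>2 = 0" for n
      using expectation_square_sum_indep[OF ind mean sq var, of n] True
      by (subst integral_nonneg_eq_0_iff_AE[symmetric]) auto
    have "AE \<omega> in M. cis ((\<Sum>i<n. Z i \<omega>) / sqrt (real n)) = 1" for n
      using zero[of n] by eventually_elim simp
    then have "(\<integral>\<omega>. cis ((\<Sum>i<n. Z i \<omega>) / sqrt (real n)) \<partial>M) = (\<integral>\<omega>. 1 \<partial>M)" for n
      by (intro integral_cong_AE) measurable
    then show ?thesis using True by (simp add: prob_space)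
  next
    case False
    with \<open>v \<ge> 0\<close> have v: "v > 0" by simp
    let ?\<sigma> = "sqrt v"
    let ?D = "\<lambda>n. distr M borel (\<lambda>\<omega>. (\<Sum>i<n. Z i \<omega>) / sqrt (real n * ?\<sigma>\<^sup>2))"
    have "weak_conv_m ?D std_normal_distribution"
      using v by (intro central_limit_theorem_zero_mean[OF ind mean _ sq]) (auto simp: mean var ident)
    then have "(\<lambda>n. char (?D n) ?\<sigma>) \<longlonglongrightarrow> char std_normal_distribution ?\<sigma>"
      by (intro levy_continuity1 real_distribution_distr real_dist_normal_dist) simp_all
    moreover have "char std_normal_distribution ?\<sigma> = complex_of_real (exp (- v / 2))"
      using v by (simp add: char_std_normal_distribution)
    moreover have "char (?D n) ?\<sigma> = (\<integral>\<omega>. cis ((\<Sum>i<n. Z i \<omega>) / sqrt (real n)) \<partial>M)" for n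
      using v by (simp add: char_def integral_distr cis_conv_exp real_sqrt_mult)
    ultimately show ?thesis by simp
  qed
qed

section \<open>Second moments and characters of Gaussian vectors\<close>

lemma normal_law_moments:
  assumes v: "v \<ge> 0"
  shows "(\<integral>x. cis x \<partial>normal_law 0 v) = complex_of_real (exp (- v / 2))"
    and "integrable (normal_law 0 v) (\<lambda>x. x\<^sup>2)"
    and "(\<integral>x. x\<^sup>2 \<partial>normal_law 0 v) = v"
proof -
  have "(\<integral>x. cis x \<partial>normal_law 0 v) = complex_of_real (exp (- v / 2)) \<and>
    integrable (normal_law 0 v) (\<lambda>x. x\<^sup>2) \<and> (\<integral>x. x\<^sup>2 \<partial>normal_law 0 v) = v"
  proof (cases "v = 0")
    case True
    interpret prob_space "return borel (0::real)" by (rule prob_space_return) simp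
    have "integrable (return borel (0::real)) (\<lambda>x. x\<^sup>2)"
      by (rule integrable_const_bound[where B = 0]) (auto simp: AE_return)
    with True show ?thesis by (simp add: normal_law_def integral_return)
  next
    case False
    with v have v: "v > 0" by simp
    have law: "normal_law 0 v = density lborel (normal_density 0 (sqrt v))"
      using v by (simp add: normal_law_def)
    interpret S: prob_space std_normal_distribution
      by (rule prob_space_normal_density) simp
    \<comment> \<open>The law is the image of the standard normal law under scaling by
      \<open>sqrt v\<close>, which reduces its character to the known one.\<close>
    have "distributed std_normal_distribution lborel (\<lambda>x. x) std_normal_density"
      by (simp add: distributed_def distr_id2)
    then have "distributed std_normal_distribution lborel (\<lambda>x. 0 + sqrt v * x)
        (normal_density (0 + sqrt v * 0) (\<bar>sqrt v\<bar> * 1))"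
      by (rule S.normal_density_affine) (use v in auto)
    then have D: "distr std_normal_distribution lborel (\<lambda>x. sqrt v * x) = normal_law 0 v"
      unfolding law using v by (simp add: distributed_def)
    have "(\<integral>x. cis x \<partial>normal_law 0 v) = char std_normal_distribution (sqrt v)"
      unfolding D[symmetric] by (simp add: integral_distr char_def cis_conv_exp)
    moreover have "has_bochner_integral lborel (\<lambda>x. normal_density 0 (sqrt v) x * x\<^sup>2) v"
      using normal_moment_even[of "sqrt v" 0 1] v by (simp add: eval_nat_numeral)
    ultimately show ?thesis
      using v unfolding law
      by (auto simp: char_std_normal_distribution integrable_density integral_density
          has_bochner_integral_iff)
  qed
  then show "(\<integral>x. cis x \<partial>normal_law 0 v) = complex_of_real (exp (- v / 2))"
    "integrable (normal_law 0 v) (\<lambda>x. x\<^sup>2)" "(\<integral>x. x\<^sup>2 \<partial>normal_law 0 v) = v" by blast+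
qed

lemma gaussian_vector_char:
  assumes Y: "gaussian_vector N Y 0 \<Sigma>" and "t \<bullet> (\<Sigma> *v t) \<ge> 0"
  shows "(\<integral>\<omega>. cis (t \<bullet> Y \<omega>) \<partial>N) = complex_of_real (exp (- (t \<bullet> (\<Sigma> *v t)) / 2))"
    and "integrable N (\<lambda>\<omega>. (t \<bullet> Y \<omega>)\<^sup>2)"
    and "(\<integral>\<omega>. (t \<bullet> Y \<omega>)\<^sup>2 \<partial>N) = t \<bullet> (\<Sigma> *v t)"
proof -
  have [measurable]: "Y \<in> borel_measurable N"
    and D: "normal_law 0 (t \<bullet> (\<Sigma> *v t)) = distr N borel (\<lambda>\<omega>. t \<bullet> Y \<omega>)"
    using Y by (simp_all add: gaussian_vector_def)
  show "(\<integral>\<omega>. cis (t \<bullet> Y \<omega>) \<partial>N) = complex_of_real (exp (- (t \<bullet> (\<Sigma> *v t)) / 2))"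
    "integrable N (\<lambda>\<omega>. (t \<bullet> Y \<omega>)\<^sup>2)" "(\<integral>\<omega>. (t \<bullet> Y \<omega>)\<^sup>2 \<partial>N) = t \<bullet> (\<Sigma> *v t)"
    using normal_law_moments[OF assms(2)] unfolding D
    by (simp_all add: integral_distr integrable_distr_eq)
qed

text \<open>The square expands into products of coordinates, whose expectations are the entries of
  \<Sigma> because the mean is zero.\<close>

lemma covariance_quadratic_form:
  fixes X :: "'w \<Rightarrow> real^'n"
  assumes cov: "has_covariance_matrix M X \<Sigma>" and mean: "integrable M X" "(\<integral>\<omega>. X \<omega> \<partial>M) = 0"
  shows "integrable M (\<lambda>\<omega>. (t \<bullet> X \<omega>)\<^sup>2)"
    and "(\<integral>\<omega>. (t \<bullet> X \<omega>)\<^sup>2 \<partial>M) = t \<bullet> (\<Sigma> *v t)"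
proof -
  have [measurable]: "X \<in> borel_measurable M" and X2: "integrable M (\<lambda>\<omega>. (norm (X \<omega>))\<^sup>2)"
    using cov by (simp_all add: has_covariance_matrix_def)
  have [measurable]: "(\<lambda>\<omega>. X \<omega> $ i) \<in> borel_measurable M" for i
    by (rule measurable_compose[of X M borel]) auto
  have mean_i: "(\<integral>\<omega>. X \<omega> $ i \<partial>M) = 0" for i
    using integral_bounded_linear[OF bounded_linear_vec_nth mean(1), of i] mean(2) by simp
  have int: "integrable M (\<lambda>\<omega>. X \<omega> $ i * X \<omega> $ j)" for i j
  proof (rule Bochner_Integration.integrable_bound[OF X2])
    show "AE \<omega> in M. norm (X \<omega> $ i * X \<omega> $ j) \<le> norm ((norm (X \<omega>))\<^sup>2)"
      by (auto simp: abs_mult power2_eq_square intro!: mult_mono component_le_norm_cart)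
  qed measurable
  have \<Sigma>: "\<Sigma> $ i $ j = (\<integral>\<omega>. X \<omega> $ i * X \<omega> $ j \<partial>M)" for i j
    using cov by (simp add: has_covariance_matrix_def mean_i)
  have eq: "(t \<bullet> X \<omega>)\<^sup>2 = (\<Sum>i\<in>UNIV. \<Sum>j\<in>UNIV. t $ i * t $ j * (X \<omega> $ i * X \<omega> $ j))" for \<omega>
    by (simp add: inner_vec_def power2_eq_square sum_product ac_simps)
  show "integrable M (\<lambda>\<omega>. (t \<bullet> X \<omega>)\<^sup>2)"
    unfolding eq using int by simp
  show "(\<integral>\<omega>. (t \<bullet> X \<omega>)\<^sup>2 \<partial>M) = t \<bullet> (\<Sigma> *v t)"
    unfolding eq using int
    by (simp add: inner_vec_def matrix_vector_mult_def \<Sigma> sum_distrib_left ac_simps)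
qed

text \<open>Reduces the second moment of the norm to those of one-dimensional projections.\<close>

lemma norm_square_eq_axis_sum: "(norm (x :: real^'n))\<^sup>2 = (\<Sum>i\<in>UNIV. (axis i 1 \<bullet> x)\<^sup>2)"
  by (simp add: norm_vec_def L2_set_def sum_nonneg inner_axis')

text \<open>In the manner of Cramer--Wold, every projection on \<open>t\<close> satisfies the
  one-dimensional theorem with variance \<open>q t\<close>, which is also the variance of the
  projection of \<eta>; hence all characters converge. Values in a Euclidean space, treated
  coordinatewise, include the complex trace.\<close>

theorem multivariate_clt:
  fixes \<xi> :: "nat \<Rightarrow> 'w \<Rightarrow> real^'n" and F :: "real^'n \<Rightarrow> 'b::euclidean_space"
  assumes M: "prob_space M" and N: "prob_space N"
    and indep: "prob_space.indep_vars M (\<lambda>_. borel) \<xi> {1..}"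
    and ident: "\<And>n. n \<ge> 1 \<Longrightarrow> distr M borel (\<xi> n) = distr M borel (\<xi> 1)"
    and mean: "\<And>n. n \<ge> 1 \<Longrightarrow> integrable M (\<xi> n) \<and> (\<integral>\<omega>. \<xi> n \<omega> \<partial>M) = 0"
    and cov: "\<And>n. n \<ge> 1 \<Longrightarrow> has_covariance_matrix M (\<xi> n) \<Sigma>"
    and gauss: "gaussian_vector N \<eta> 0 \<Sigma>"
    and F: "continuous_on UNIV F" "bounded (range F)"
  shows "(\<lambda>n. \<integral>\<omega>. F (\<Sum>k=1..n. \<xi> k \<omega> /\<^sub>R sqrt (real n)) \<partial>M) \<longlonglongrightarrow> (\<integral>\<omega>. F (\<eta> \<omega>) \<partial>N)"
proof -
  interpret M: prob_space M by fact
  interpret N: prob_space N by fact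
  define q where "q t = t \<bullet> (\<Sigma> *v t)" for t
  define X where "X n \<omega> = (\<Sum>k=1..n. \<xi> k \<omega> /\<^sub>R sqrt (real n))" for n \<omega>
  define Z where "Z t i = (\<lambda>\<omega>. t \<bullet> \<xi> (Suc i) \<omega>)" for t i
  have \<xi> [measurable]: "\<xi> (Suc i) \<in> borel_measurable M" for i
    using cov[of "Suc i"] by (simp add: has_covariance_matrix_def)
  have \<xi>' [measurable]: "\<xi> k \<in> borel_measurable M" if "k \<in> {1..n}" for k n
    using \<xi>[of "k - 1"] that by (cases k) auto
  have \<eta> [measurable]: "\<eta> \<in> borel_measurable N"
    using gauss by (simp add: gaussian_vector_def)
  have X [measurable]: "X n \<in> borel_measurable M" for n
    unfolding X_def by measurable
  have tX: "t \<bullet> X n \<omega> = (\<Sum>i<n. Z t i \<omega>) / sqrt (real n)" for t n \<omega>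
    by (simp add: X_def Z_def inner_sum_right sum.atLeast1_atMost_eq sum_distrib_left
        divide_inverse mult.commute)
  have ind: "M.indep_vars (\<lambda>_. borel) (Z t) UNIV" for t
    unfolding Z_def
    by (rule M.indep_vars_compose2[OF M.indep_vars_Suc[OF indep], of "\<lambda>_ x. t \<bullet> x"]) simp
  have Z_mean: "M.expectation (Z t i) = 0" for t i
    using mean[of "Suc i"] by (simp add: Z_def)
  have Z_sq: "integrable M (\<lambda>\<omega>. (Z t i \<omega>)\<^sup>2)" "M.expectation (\<lambda>\<omega>. (Z t i \<omega>)\<^sup>2) = q t" for t i
    using covariance_quadratic_form[OF cov, of "Suc i" t] mean[of "Suc i"]
    by (simp_all add: Z_def q_def)
  have Z_ident: "distr M borel (Z t i) = distr (distr M borel (\<xi> 1)) borel (\<lambda>x. t \<bullet> x)" for t i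
    using ident[of "Suc i", symmetric] by (simp add: distr_distr Z_def o_def)
  \<comment> \<open>The quadratic form of \<Sigma> is a second moment; this supplies the
    nonnegativity that the Gaussian formulas ask for.\<close>
  have q0: "q t \<ge> 0" for t
    unfolding Z_sq(2)[of t 0, symmetric] by simp
  note \<eta>_char = gaussian_vector_char[OF gauss q0[unfolded q_def], folded q_def]
  \<comment> \<open>The second moment equals \<open>q t\<close> for positive \<open>n\<close>, but
    is 0 for \<open>n = 0\<close>; hence the inequality.\<close>
  have X_sq: "integrable M (\<lambda>\<omega>. (t \<bullet> X n \<omega>)\<^sup>2)" "M.expectation (\<lambda>\<omega>. (t \<bullet> X n \<omega>)\<^sup>2) \<le> q t" for t n
    using M.expectation_square_sum_indep[OF ind Z_mean Z_sq, of t n] q0[of t]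
    by (simp_all add: tX power_divide)
  \<comment> \<open>This is the trace of \<Sigma>.\<close>
  define S where "S = (\<Sum>i\<in>UNIV. q (axis i 1))"
  have real_case: "(\<lambda>n. \<integral>\<omega>. f (X n \<omega>) \<partial>M) \<longlonglongrightarrow> (\<integral>\<omega>. f (\<eta> \<omega>) \<partial>N)"
    if f: "continuous_on UNIV f" "bounded (range f)" for f :: "real^'n \<Rightarrow> real"
  proof (rule expectation_tendsto_of_characters[OF M X N \<eta> _ _ _ _ _ f])
    show "(\<lambda>n. \<integral>\<omega>. cis (t \<bullet> X n \<omega>) \<partial>M) \<longlonglongrightarrow> (\<integral>\<omega>. cis (t \<bullet> \<eta> \<omega>) \<partial>N)" for t
      unfolding tX \<eta>_char(1) by (rule M.clt_characters[OF ind Z_mean Z_sq Z_ident])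
    show "integrable M (\<lambda>\<omega>. (norm (X n \<omega>))\<^sup>2)" "(\<integral>\<omega>. (norm (X n \<omega>))\<^sup>2 \<partial>M) \<le> S" for n
      unfolding norm_square_eq_axis_sum S_def by (auto simp: X_sq intro!: sum_mono)
    show "integrable N (\<lambda>\<omega>. (norm (\<eta> \<omega>))\<^sup>2)" "(\<integral>\<omega>. (norm (\<eta> \<omega>))\<^sup>2 \<partial>N) \<le> S"
      unfolding norm_square_eq_axis_sum S_def by (simp_all add: \<eta>_char)
  qed
  have F_meas: "F \<in> borel_measurable borel"
    by (rule borel_measurable_continuous_onI[OF F(1)])
  obtain K where K: "\<And>x. norm (F x) \<le> K" using F(2) by (auto simp: bounded_iff)
  have int: "integrable M (\<lambda>\<omega>. F (X n \<omega>))" "integrable N (\<lambda>\<omega>. F (\<eta> \<omega>))" for n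
    using K by (auto intro!: M.integrable_const_bound[where B = K] N.integrable_const_bound[where B = K]
        measurable_compose[OF _ F_meas])
  have "(\<lambda>n. (\<integral>\<omega>. F (X n \<omega>) \<partial>M) \<bullet> b) \<longlonglongrightarrow> (\<integral>\<omega>. F (\<eta> \<omega>) \<partial>N) \<bullet> b"
    if "b \<in> Basis" for b
  proof -
    have cont: "continuous_on UNIV (\<lambda>x. F x \<bullet> b)"
      by (intro continuous_intros F(1))
    have "\<bar>F x \<bullet> b\<bar> \<le> K" for x
      using Basis_le_norm[OF that, of "F x"] K[of x] by linarith
    then have bdd: "bounded (range (\<lambda>x. F x \<bullet> b))"
      by (auto simp: bounded_iff)
    have "(\<integral>\<omega>. F (X n \<omega>) \<bullet> b \<partial>M) = (\<integral>\<omega>. F (X n \<omega>) \<partial>M) \<bullet> b" for n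
      by (rule integral_inner_left[OF int(1)])
    moreover have "(\<integral>\<omega>. F (\<eta> \<omega>) \<bullet> b \<partial>N) = (\<integral>\<omega>. F (\<eta> \<omega>) \<partial>N) \<bullet> b"
      by (rule integral_inner_left[OF int(2)])
    ultimately show ?thesis
      using real_case[OF cont bdd] by (simp only:)
  qed
  then have "(\<lambda>n. \<integral>\<omega>. F (X n \<omega>) \<partial>M) \<longlonglongrightarrow> (\<integral>\<omega>. F (\<eta> \<omega>) \<partial>N)"
    unfolding tendsto_componentwise_iff[of "\<lambda>n. \<integral>\<omega>. F (X n \<omega>) \<partial>M"] by blast
  then show ?thesis by (simp add: X_def)
qed

section \<open>Convergence of the pure states\<close>

theorem theorem4p2:
  fixes M :: "'w measure" and N :: "'v measure"
    and u :: "(real ^ 'n) L2"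
    and \<xi> :: "nat \<Rightarrow> 'w \<Rightarrow> real ^ 'n"
    and \<eta> :: "'v \<Rightarrow> real ^ 'n"
    and \<Sigma> :: "real ^ 'n ^ 'n"
  assumes "prob_space M" and "prob_space N"
    and indep: "prob_space.indep_vars M (\<lambda>_. borel) \<xi> {1..}"
    and ident: "\<And>n. n \<ge> 1 \<Longrightarrow> distr M borel (\<xi> n) = distr M borel (\<xi> 1)"
    and mean: "\<And>n. n \<ge> 1 \<Longrightarrow> integrable M (\<xi> n) \<and> (\<integral>\<omega>. \<xi> n \<omega> \<partial>M) = 0"
    and cov: "\<And>n. n \<ge> 1 \<Longrightarrow> has_covariance_matrix M (\<xi> n) \<Sigma>"
    and gauss: "gaussian_vector N \<eta> 0 \<Sigma>"
  shows "wot_conv_in_distr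
           M (\<lambda>n \<omega>. pure_state (shift_prod n (\<lambda>k. \<xi> k \<omega> /\<^sub>R sqrt (real n)) u))
           N (\<lambda>\<omega>. pure_state (shift_op (\<eta> \<omega>) u)) \<and>
         (\<forall>A. bounded_clinear A \<longrightarrow>
           (\<lambda>n. \<integral>\<omega>. op_trace (pure_state (shift_prod n (\<lambda>k. \<xi> k \<omega> /\<^sub>R sqrt (real n)) u) \<circ> A) \<partial>M)
             \<longlonglongrightarrow> (\<integral>\<omega>. op_trace (pure_state (shift_op (\<eta> \<omega>) u) \<circ> A) \<partial>N))"
proof -
  let ?X = "\<lambda>n \<omega>. \<Sum>k=1..n. \<xi> k \<omega> /\<^sub>R sqrt (real n)"
  define g where "g A a = cinner (shift_op a u) (A (shift_op a u))" for A and a :: "real^'n"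
  have \<eta>: "\<eta> \<in> borel_measurable N"
    using gauss by (simp add: gaussian_vector_def)
  have "\<xi> k \<in> borel_measurable M" if "k \<in> {1..n}" for k n
    using cov[of k] that by (simp add: has_covariance_matrix_def)
  then have X: "?X n \<in> borel_measurable M" for n
    by measurable
  have trace: "op_trace (pure_state (shift_prod n (\<lambda>k. \<xi> k \<omega> /\<^sub>R sqrt (real n)) u) \<circ> A) = g A (?X n \<omega>)"
    "op_trace (pure_state (shift_op a u) \<circ> A) = g A a"
    if "bounded_clinear A" for A n \<omega> a
    using that by (simp_all add: op_trace_pure_state shift_prod_eq g_def)
  have cont: "continuous_on UNIV (g A)" and bdd: "bounded (range (g A))" if "bounded_clinear A" for A
    unfolding g_def using continuous_cinner_shift_op[OF that] bounded_cinner_shift_op[OF that] by auto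
  have "conv_in_distr M (\<lambda>n \<omega>. g A (?X n \<omega>)) N (\<lambda>\<omega>. g A (\<eta> \<omega>))" if A: "bounded_clinear A" for A
    unfolding conv_in_distr_def
  proof (intro conjI allI impI)
    have "g A \<in> borel_measurable borel"
      by (rule borel_measurable_continuous_onI[OF cont[OF A]])
    then show "(\<lambda>\<omega>. g A (?X n \<omega>)) \<in> borel_measurable M" "(\<lambda>\<omega>. g A (\<eta> \<omega>)) \<in> borel_measurable N" for n
      using X \<eta> by (auto intro: measurable_compose)
    fix f :: "complex \<Rightarrow> real"
    assume f: "continuous_on UNIV f \<and> bounded (range f)"
    show "(\<lambda>n. \<integral>\<omega>. f (g A (?X n \<omega>)) \<partial>M) \<longlonglongrightarrow> (\<integral>\<omega>. f (g A (\<eta> \<omega>)) \<partial>N)"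
    \<comment> \<open>The test function on the line of traces is pulled back along
      \<open>g A\<close> to a bounded continuous function of the random vector.\<close>
    proof (rule multivariate_clt[OF assms])
      show "continuous_on UNIV (\<lambda>x. f (g A x))"
        using f by (intro continuous_on_compose2[OF _ cont[OF A]]) auto
      show "bounded (range (\<lambda>x. f (g A x)))"
        using f by (auto intro: bounded_subset)
    qed
  qed
  \<comment> \<open>Here the complex-valued \<open>g A\<close> is itself the test function.\<close>
  moreover have "(\<lambda>n. \<integral>\<omega>. g A (?X n \<omega>) \<partial>M) \<longlonglongrightarrow> (\<integral>\<omega>. g A (\<eta> \<omega>) \<partial>N)"
    if "bounded_clinear A" for A
    by (rule multivariate_clt[OF assms cont[OF that] bdd[OF that]])
  ultimately show ?thesis
    unfolding wot_conv_in_distr_def by (simp add: trace)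
qed

end
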